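(* Let $m\in\mathbb Z_{>1}$, $n\in\mathbb Z_{>0}$ and let $J_i^{(m)}:=[(i-1)m+1,(i+1)m-1]$, $i\in\mathbb Z_{>0}$. (a) The assignments $T_i\mapsto T_{w_{J_i^{(m)}\setminus\{im\};\,J_i^{(m)}}}$, $i\in[1,n-1]$, define a strict parabolic Coxeter type homomorphism $\Phi_n^{(m)}:\mathrm{Br}^+_n\to\mathrm{Br}^+_{nm}$. (b) The assignments $T_i\mapsto T_{w_\circ^{J_i^{(m)}}}$, $i\in[1,n-1]$, define a standard homomorphism $\widehat\Phi_n^{(m)}:\mathrm{Br}^+_n\to\mathrm{Br}^+_{nm}$. Let $\widehat M=B_n$, $\widetilde M=B_{mn}$. (c) The assignments $\widehat T_i\mapsto\widetilde T_{w_{J_i^{(m)}\setminus\{im\};\,J_i^{(m)}}}$, $i\in[1,n-1]$, $\widehat T_n\mapsto\widetilde T_{w_{[(n-1)m+1,nm-1];\,[(n-1)m+1,nm]}}$ define a parabolic Coxeter type homomorphism $\mathrm{Br}^+(\widehat M)\to\mathrm{Br}^+(\widetilde M)$. (d) The assignments $\widehat T_i\mapsto\widetilde T_{w_\circ^{J_i^{(m)}}}$, $i\in[1,n-1]$, $\widehat T_n\mapsto\widetilde T_{w_\circ^{[(n-1)m+1,nm]}}$ define a standard homomorphism $\mathrm{Br}^+(\widehat M)\to\mathrm{Br}^+(\widetilde M)$.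
   Context: $[a,b]=\{i\in\mathbb Z:a\le i\le b\}$. For a Coxeter matrix $M=(m_{ij})_{i,j\in I}$ (symmetric, $m_{ii}=1$, $m_{ij}\in\mathbb Z_{\ge2}\cup\{\infty\}$ for $i\ne j$), the Artin monoid $\mathrm{Br}^+(M)$ is generated by $T_i$, $i\in I$, subject to $T_iT_jT_i\cdots=T_jT_iT_j\cdots$ ($m_{ij}$ factors) for $i\neq j$, $m_{ij}<\infty$; $W(M)$ is the Coxeter group with simple generators $s_i$. $\mathrm{Br}^+_n=\mathrm{Br}^+(A_{n-1})$, where $A_k$ has index set $[1,k]$, $m_{ij}=3$ if $|i-j|=1$, $2$ if $|i-j|>1$; $B_k$ ($k\ge2$) is the same except $m_{k-1,k}=4$. For $w\in W(M)$, $T_w$ is the product of the $T_i$ along any reduced expression of $w$. For $K\subset I$ with $W_K(M)=\langle s_k:k\in K\rangle$ finite, $w_\circ^K$ is its longest element; $w_{J;K}=w_\circ^Jw_\circ^K$ for $J\subset K$. $\widehat T_\bullet$, $\widetilde T_\bullet$ denote elements of $\mathrm{Br}^+(\widehat M)$, $\mathrm{Br}^+(\widetilde M)$. For a homomorphism $\Phi:\mathrm{Br}^+(\widehat M)\to\mathrm{Br}^+(M)$ of Artin monoids of finite type, let $[\Phi](\widehat I)\subset I$ be the set of indices of generators occurring in the elements $\Phi(\widehat T_i)$, $i\in\widehat I$. $\Phi$ is: – of Coxeter type if it induces a group homomorphism $W(\widehat M)\to W(M)$ via the canonical projections $T_i\mapsto s_i$; – standard if each $\Phi(\widehat T_i)$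 is of the form $T_{w_\circ^{J_i}}$, $J_i\subset I$; – strict parabolic if for every $\widehat J\subset\widehat I$ there is $J\subset K:=[\Phi](\widehat I)$ with $\Phi(\widehat T_{w_{\widehat J;\widehat I}})=T_{w_{J;K}}$; – parabolic if $\Phi(\mathsf P(\mathrm{Br}^+(\widehat M)))\subset\mathsf P(\mathrm{Br}^+_{[\Phi](\widehat I)}(M))$, where for $K$ with connected components $K_1,\dots,K_r$ (with respect to edges $m_{ij}>2$) $\mathsf P(\mathrm{Br}^+_K(M))$ is the submonoid generated by all $T_{w_{J;K_i}}$, $1\le i\le r$, $J\subset K_i$. *)

theory Defs
  imports "HOL-Library.Extended_Nat" "HOL-Algebra.Generated_Groups"
begin

section \<open>Monoids given by generators and relations\<close>

inductive word_cong :: "'i set \<Rightarrow> ('i list \<times> 'i list) set \<Rightarrow> 'i list \<Rightarrow> 'i list \<Rightarrow> bool"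
  for I R where
  rel: "(u, v) \<in> R \<Longrightarrow> u \<in> lists I \<Longrightarrow> v \<in> lists I \<Longrightarrow> word_cong I R u v"
| refl: "u \<in> lists I \<Longrightarrow> word_cong I R u u"
| sym: "word_cong I R u v \<Longrightarrow> word_cong I R v u"
| trans: "word_cong I R u v \<Longrightarrow> word_cong I R v w \<Longrightarrow> word_cong I R u w"
| append: "word_cong I R u u' \<Longrightarrow> word_cong I R v v' \<Longrightarrow> word_cong I R (u @ v) (u' @ v')"

definition word_class :: "'i set \<Rightarrow> ('i list \<times> 'i list) set \<Rightarrow> 'i list \<Rightarrow> 'i list set" where
  "word_class I R u = {v. word_cong I R u v}"

definition presented_monoid :: "'i set \<Rightarrow> ('i list \<times> 'i list) set \<Rightarrow> 'i list set monoid" where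
  "presented_monoid I R =
     \<lparr> carrier = word_class I R ` lists I,
       monoid.mult = (\<lambda>x y. {w. \<exists>u\<in>x. \<exists>v\<in>y. word_cong I R (u @ v) w}),
       one = word_class I R [] \<rparr>"

lemma word_cong_lists: "word_cong I R u v \<Longrightarrow> u \<in> lists I \<and> v \<in> lists I"
  by (induction rule: word_cong.induct) auto

lemma word_class_eq_iff:
  assumes "u \<in> lists I"
  shows "word_class I R u = word_class I R v \<longleftrightarrow> word_cong I R u v"
  using assms unfolding word_class_def
  by (auto intro: word_cong.intros)

lemma carrier_presented_monoid [simp]:
  "carrier (presented_monoid I R) = word_class I R ` lists I"
  by (simp add: presented_monoid_def)

lemma one_presented_monoid [simp]: "\<one>\<^bsub>presented_monoid I R\<^esub> = word_class I R []"
  by (simp add: presented_monoid_def)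

lemma mult_presented_monoid:
  assumes "u \<in> lists I" "v \<in> lists I"
  shows "word_class I R u \<otimes>\<^bsub>presented_monoid I R\<^esub> word_class I R v = word_class I R (u @ v)"
proof -
  have "word_cong I R (u @ v) w"
    if "word_cong I R u u'" "word_cong I R v v'" "word_cong I R (u' @ v') w" for u' v' w
    using that by (blast intro: word_cong.append word_cong.trans)
  moreover have "word_cong I R u u" "word_cong I R v v"
    using assms by (auto intro: word_cong.refl)
  ultimately show ?thesis
    unfolding presented_monoid_def word_class_def by auto
qed

lemma monoid_presented_monoid: "monoid (presented_monoid I R)"
  by (rule monoidI) (auto simp: mult_presented_monoid in_lists_conv_set ball_Un intro!: imageI)

text \<open>The library's \<^const>\<open>hom\<close> does not require preservation of the unit, which is not
  automatic for monoids.\<close>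

definition monoid_hom :: "('a, 'm) monoid_scheme \<Rightarrow> ('b, 'n) monoid_scheme \<Rightarrow> ('a \<Rightarrow> 'b) set" where
  "monoid_hom G H = {h \<in> hom G H. h \<one>\<^bsub>G\<^esub> = \<one>\<^bsub>H\<^esub>}"

definition submonoid_generated :: "('a, 'm) monoid_scheme \<Rightarrow> 'a set \<Rightarrow> 'a set" where
  "submonoid_generated G S = (\<lambda>H. submonoid H G) hull S"


section \<open>Coxeter matrices, Artin monoids and Coxeter groups\<close>

record 'i coxeter =
  index :: "'i set"
  mat :: "'i \<Rightarrow> 'i \<Rightarrow> enat"

definition coxeter_matrix :: "'i coxeter \<Rightarrow> bool" where
  "coxeter_matrix M \<longleftrightarrow>
     (\<forall>i\<in>index M. \<forall>j\<in>index M. mat M i j = mat M j i) \<and>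
     (\<forall>i\<in>index M. mat M i i = 1) \<and>
     (\<forall>i\<in>index M. \<forall>j\<in>index M. i \<noteq> j \<longrightarrow> 2 \<le> mat M i j)"

fun alternating :: "'i \<Rightarrow> 'i \<Rightarrow> nat \<Rightarrow> 'i list" where
  "alternating i j 0 = []"
| "alternating i j (Suc k) = i # alternating j i k"

definition braid_relations :: "'i coxeter \<Rightarrow> ('i list \<times> 'i list) set" where
  "braid_relations M =
     {(alternating i j k, alternating j i k) | i j k.
        i \<in> index M \<and> j \<in> index M \<and> i \<noteq> j \<and> mat M i j = enat k}"

text \<open>The relations \<open>(s\<^sub>i s\<^sub>j)\<^bsup>m\<^sub>i\<^sub>j\<^esup> = 1\<close>; the case \<open>i = j\<close> is \<open>s\<^sub>i\<^sup>2 = 1\<close>. As every generator is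
  its own inverse, the monoid with this presentation is the Coxeter group.\<close>

definition coxeter_relations :: "'i coxeter \<Rightarrow> ('i list \<times> 'i list) set" where
  "coxeter_relations M =
     {(concat (replicate k [i, j]), []) | i j k.
        i \<in> index M \<and> j \<in> index M \<and> mat M i j = enat k}"

definition artin_monoid :: "'i coxeter \<Rightarrow> 'i list set monoid" where
  "artin_monoid M = presented_monoid (index M) (braid_relations M)"

definition coxeter_group :: "'i coxeter \<Rightarrow> 'i list set monoid" where
  "coxeter_group M = presented_monoid (index M) (coxeter_relations M)"

definition artin_word :: "'i coxeter \<Rightarrow> 'i list \<Rightarrow> 'i list set" where
  "artin_word M = word_class (index M) (braid_relations M)"

definition coxeter_word :: "'i coxeter \<Rightarrow> 'i list \<Rightarrow> 'i list set" where
  "coxeter_word M = word_class (index M) (coxeter_relations M)"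

definition artin_gen :: "'i coxeter \<Rightarrow> 'i \<Rightarrow> 'i list set" where
  "artin_gen M i = artin_word M [i]"

definition coxeter_gen :: "'i coxeter \<Rightarrow> 'i \<Rightarrow> 'i list set" where
  "coxeter_gen M i = coxeter_word M [i]"

lemma monoid_artin_monoid: "monoid (artin_monoid M)"
  unfolding artin_monoid_def by (rule monoid_presented_monoid)

lemma group_coxeter_group:
  assumes "coxeter_matrix M"
  shows "group (coxeter_group M)"
proof -
  let ?I = "index M" and ?R = "coxeter_relations M"
  have sq: "word_cong ?I ?R [i, i] []" if "i \<in> ?I" for i
  proof (rule word_cong.rel)
    have "mat M i i = enat 1"
      using assms that by (auto simp: coxeter_matrix_def one_enat_def)
    then have "(concat (replicate 1 [i, i]), []) \<in> ?R"
      using that unfolding coxeter_relations_def by blast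
    then show "([i, i], []) \<in> ?R" by simp
  qed (use that in auto)
  have inv: "word_cong ?I ?R (rev u @ u) []" if "u \<in> lists ?I" for u
    using that
  proof (induction u)
    case Nil
    show ?case by (auto intro: word_cong.refl)
  next
    case (Cons a u)
    have "word_cong ?I ?R (rev u @ ([a, a] @ u)) (rev u @ ([] @ u))"
      by (intro word_cong.append word_cong.refl sq) (use Cons in auto)
    with Cons show ?case by (auto intro: word_cong.trans)
  qed
  interpret monoid "coxeter_group M"
    unfolding coxeter_group_def by (rule monoid_presented_monoid)
  show ?thesis
  proof (rule group_l_invI)
    fix x assume "x \<in> carrier (coxeter_group M)"
    then obtain u where u: "u \<in> lists ?I" "x = word_class ?I ?R u"
      by (auto simp: coxeter_group_def)
    have r: "rev u \<in> lists ?I" using u by auto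
    have "word_class ?I ?R (rev u) \<otimes>\<^bsub>coxeter_group M\<^esub> x = \<one>\<^bsub>coxeter_group M\<^esub>"
      unfolding coxeter_group_def u(2) mult_presented_monoid[OF r u(1)] one_presented_monoid
      using inv[OF u(1)] u r by (subst word_class_eq_iff) auto
    with r show "\<exists>y\<in>carrier (coxeter_group M).
        y \<otimes>\<^bsub>coxeter_group M\<^esub> x = \<one>\<^bsub>coxeter_group M\<^esub>"
      by (auto simp: coxeter_group_def)
  qed
qed

definition coxeter_length :: "'i coxeter \<Rightarrow> 'i list set \<Rightarrow> nat" where
  "coxeter_length M w = (LEAST l. \<exists>u\<in>lists (index M). coxeter_word M u = w \<and> length u = l)"

definition reduced_expression :: "'i coxeter \<Rightarrow> 'i list set \<Rightarrow> 'i list \<Rightarrow> bool" where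
  "reduced_expression M w u \<longleftrightarrow>
     u \<in> lists (index M) \<and> coxeter_word M u = w \<and> length u = coxeter_length M w"

text \<open>By Matsumoto's theorem the product does not depend on the reduced expression.\<close>

definition artin_lift :: "'i coxeter \<Rightarrow> 'i list set \<Rightarrow> 'i list set" where
  "artin_lift M w = (THE t. \<exists>u. reduced_expression M w u \<and> t = artin_word M u)"

definition parabolic_subgroup :: "'i coxeter \<Rightarrow> 'i set \<Rightarrow> 'i list set set" where
  "parabolic_subgroup M K = generate (coxeter_group M) (coxeter_gen M ` K)"

text \<open>Only meaningful if \<^term>\<open>parabolic_subgroup M K\<close> is finite.\<close>

definition longest :: "'i coxeter \<Rightarrow> 'i set \<Rightarrow> 'i list set" where
  "longest M K = (THE w. w \<in> parabolic_subgroup M K \<and>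
     (\<forall>v\<in>parabolic_subgroup M K. coxeter_length M v \<le> coxeter_length M w))"

text \<open>The element \<open>w\<^bsub>J;K\<^esub>\<close>.\<close>

definition longest_rel :: "'i coxeter \<Rightarrow> 'i set \<Rightarrow> 'i set \<Rightarrow> 'i list set" where
  "longest_rel M J K = longest M J \<otimes>\<^bsub>coxeter_group M\<^esub> longest M K"


section \<open>Types \<open>A\<close> and \<open>B\<close>\<close>

definition type_A :: "int \<Rightarrow> int coxeter" where
  "type_A k = \<lparr> index = {1..k},
     mat = (\<lambda>i j. if i = j then 1 else if \<bar>i - j\<bar> = 1 then 3 else 2) \<rparr>"

text \<open>The formula also covers \<open>k = 1\<close>, where it gives \<open>B\<^sub>1 = A\<^sub>1\<close>.\<close>

definition type_B :: "int \<Rightarrow> int coxeter" where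
  "type_B k = \<lparr> index = {1..k},
     mat = (\<lambda>i j. if {i, j} = {k - 1, k} then 4 else mat (type_A k) i j) \<rparr>"

lemma coxeter_matrix_type_A: "coxeter_matrix (type_A k)"
  by (auto simp: coxeter_matrix_def type_A_def abs_minus_commute)

lemma coxeter_matrix_type_B: "coxeter_matrix (type_B k)"
  using coxeter_matrix_type_A[of k]
  by (auto simp: coxeter_matrix_def type_B_def type_A_def insert_commute doubleton_eq_iff)


section \<open>Classes of homomorphisms of Artin monoids\<close>

text \<open>Braid relations have the same letters on both sides, so all words in an element of the
  Artin monoid have the same letters.\<close>

definition artin_support :: "'i list set \<Rightarrow> 'i set" where
  "artin_support x = (\<Union>u\<in>x. set u)"

text \<open>The set \<open>[\<Phi>](\<open>I'\<close>)\<close>, where \<open>I'\<close> is the index set of \<open>M'\<close>.\<close>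

definition hom_support :: "'j coxeter \<Rightarrow> ('j list set \<Rightarrow> 'i list set) \<Rightarrow> 'i set" where
  "hom_support M' \<Phi> = (\<Union>i\<in>index M'. artin_support (\<Phi> (artin_gen M' i)))"

text \<open>The canonical projection \<open>T\<^sub>i \<mapsto> s\<^sub>i\<close>; the words in an element of the Artin monoid all
  represent the same element of the Coxeter group, so the union is a single class.\<close>

definition artin_to_coxeter :: "'i coxeter \<Rightarrow> 'i list set \<Rightarrow> 'i list set" where
  "artin_to_coxeter M x = (\<Union>u\<in>x. coxeter_word M u)"

definition coxeter_type ::
    "'j coxeter \<Rightarrow> 'i coxeter \<Rightarrow> ('j list set \<Rightarrow> 'i list set) \<Rightarrow> bool" where
  "coxeter_type M' M \<Phi> \<longleftrightarrow>
     (\<exists>\<phi>\<in>hom (coxeter_group M') (coxeter_group M).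
        \<forall>x\<in>carrier (artin_monoid M'). \<phi> (artin_to_coxeter M' x) = artin_to_coxeter M (\<Phi> x))"

definition standard_hom ::
    "'j coxeter \<Rightarrow> 'i coxeter \<Rightarrow> ('j list set \<Rightarrow> 'i list set) \<Rightarrow> bool" where
  "standard_hom M' M \<Phi> \<longleftrightarrow>
     (\<forall>i\<in>index M'. \<exists>J\<subseteq>index M. \<Phi> (artin_gen M' i) = artin_lift M (longest M J))"

definition strict_parabolic ::
    "'j coxeter \<Rightarrow> 'i coxeter \<Rightarrow> ('j list set \<Rightarrow> 'i list set) \<Rightarrow> bool" where
  "strict_parabolic M' M \<Phi> \<longleftrightarrow>
     (\<forall>J'\<subseteq>index M'. \<exists>J\<subseteq>hom_support M' \<Phi>.
        \<Phi> (artin_lift M' (longest_rel M' J' (index M'))) =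
        artin_lift M (longest_rel M J (hom_support M' \<Phi>)))"

definition components :: "'i coxeter \<Rightarrow> 'i set \<Rightarrow> 'i set set" where
  "components M K = K // {(i, j) \<in> K \<times> K. (i, j) \<in> {(a, b) \<in> K \<times> K. mat M a b > 2}\<^sup>*}"

text \<open>The submonoid \<open>P(Br\<^sup>+\<^sub>K(M))\<close>.\<close>

definition parabolic_submonoid :: "'i coxeter \<Rightarrow> 'i set \<Rightarrow> 'i list set set" where
  "parabolic_submonoid M K = submonoid_generated (artin_monoid M)
     {artin_lift M (longest_rel M J C) | J C. C \<in> components M K \<and> J \<subseteq> C}"

definition parabolic_hom ::
    "'j coxeter \<Rightarrow> 'i coxeter \<Rightarrow> ('j list set \<Rightarrow> 'i list set) \<Rightarrow> bool" where
  "parabolic_hom M' M \<Phi> \<longleftrightarrow>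
     \<Phi> ` parabolic_submonoid M' (index M') \<subseteq> parabolic_submonoid M (hom_support M' \<Phi>)"


section \<open>The intervals \<open>J\<^sub>i\<^sup>(\<^sup>m\<^sup>)\<close>\<close>

definition J_block :: "int \<Rightarrow> int \<Rightarrow> int set" where
  "J_block m i = {(i - 1) * m + 1 .. (i + 1) * m - 1}"

end

theory Submission
  imports Defs "HOL-Library.Multiset"
begin

text \<open>Realise \<open>W(B\<^sub>k)\<close> by the permutations \<open>w\<close> of the integers with finite support and
  \<open>w (- 1 - x) = - 1 - w x\<close>, the generator \<open>s\<^sub>i\<close> exchanging \<open>d - 1\<close> and \<open>d\<close>, and their mirror
  images, for \<open>d = k - i\<close>; then \<open>A\<^bsub>k-1\<^esub>\<close> is the parabolic part with \<open>d > 0\<close>. Length is the number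
  of inversions up to mirror symmetry, and Matsumoto's theorem follows by comparing two right
  descents. The maps of (a) and (c) replace every line of a braid by a ribbon of \<open>m\<close> parallel
  lines: on permutations this is \<open>x \<mapsto> m * w (x div m) + x mod m\<close>, it sends reduced words to reduced
  words, and it sends \<open>w\<^bsub>J;K\<^esub>\<close> to an element of the same kind because a longest element is the
  ribbon version of a longest element times the reversal of the lines inside each ribbon. The maps
  of (b) and (d) add a half twist to both ribbons at each crossing. Half twists can be moved through
  crossings, and the two sides of a braid relation put the same number of them on each ribbon.\<close>

section \<open>Mirror symmetric permutations and their inversions\<close>

text \<open>Equality in an Artin monoid is hard to test directly, so almost every identity is
  obtained by exhibiting two reduced words with the same permutation. This suffices for (a) and (c)
  but not for (b) and (d): there \<open>T_1 T_2 T_1\<close> is sent to a product of longest elements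
  that is not reduced when \<open>m > 1\<close>. Hence each longest element is split into a ribbon
  crossing and half twists; every single commutation is again a comparison of reduced words, and
  only the twists left over are compared as multisets. The mirror \<open>x \<mapsto> - 1 - x\<close>
  is centred between \<open>- 1\<close> and \<open>0\<close>, so it fixes no line and, as division
  by \<open>m\<close> rounds down, it carries ribbons to ribbons. Counting positions from the
  special end puts the bond of order 4 at positions 0 and 1 for every rank, so one family of
  reflections serves all ranks and both types. The two pairs exchanged by \<open>refl_at 0\<close>
  coincide: it is the single transposition of \<open>- 1\<close> and \<open>0\<close>, the sign
  change of type B.\<close>

definition refl_at :: "int \<Rightarrow> int \<Rightarrow> int" where
  "refl_at d x = (if x = d - 1 then d else if x = d then d - 1
     else if x = - d then - d - 1 else if x = - d - 1 then - d else x)"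

lemma refl_at_refl_at [simp]: "refl_at d (refl_at d x) = x"
  by (auto simp: refl_at_def)

lemma refl_at_comp_self [simp]: "refl_at d \<circ> refl_at d = id"
  by (auto simp: fun_eq_iff)

lemma refl_at_mirror: "refl_at d (- 1 - x) = - 1 - refl_at d x"
  by (auto simp: refl_at_def; presburger)

lemma refl_at_inverts:
  assumes "a < b" "refl_at d b \<le> refl_at d a"
  shows "(a = d - 1 \<and> b = d) \<or> (a = - d - 1 \<and> b = - d)"
  using assms by (auto simp: refl_at_def split: if_splits)

definition sym_perm :: "(int \<Rightarrow> int) \<Rightarrow> bool" where
  "sym_perm w \<longleftrightarrow> bij w \<and> (\<forall>x. w (- 1 - x) = - 1 - w x)"

lemma sym_perm_inj: "sym_perm w \<Longrightarrow> w x = w y \<longleftrightarrow> x = y"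
  by (auto simp: sym_perm_def bij_def inj_eq)

lemma sym_perm_mirror: "sym_perm w \<Longrightarrow> w (- 1 - x) = - 1 - w x"
  by (auto simp: sym_perm_def)

lemma sym_perm_id [simp]: "sym_perm id"
  by (auto simp: sym_perm_def)

lemma sym_perm_comp: "sym_perm v \<Longrightarrow> sym_perm w \<Longrightarrow> sym_perm (v \<circ> w)"
  by (auto simp: sym_perm_def intro: bij_comp)

lemma sym_perm_refl_at [simp]: "sym_perm (refl_at d)"
  unfolding sym_perm_def using o_bij[OF refl_at_comp_self refl_at_comp_self] refl_at_mirror by auto

lemma sym_perm_inv:
  assumes "sym_perm w"
  shows "sym_perm (inv_into UNIV w)"
  unfolding sym_perm_def
proof (intro conjI allI)
  have b: "bij w" using assms by (simp add: sym_perm_def)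
  then show "bij (inv_into UNIV w)" by (rule bij_imp_bij_inv)
  fix x
  have "w (- 1 - inv_into UNIV w x) = - 1 - x"
    using sym_perm_mirror[OF assms] b by (simp add: bij_is_surj surj_f_inv_f)
  then show "inv_into UNIV w (- 1 - x) = - 1 - inv_into UNIV w x"
    using b by (metis bij_inv_eq_iff)
qed

text \<open>An increasing bijection of the integers is a translation, and
  \<open>w (- 1) = - 1 - w 0\<close> leaves only the translation by 0.\<close>

lemma strict_mono_sym_perm:
  assumes w: "sym_perm w" and mono: "\<And>a b. a < b \<Longrightarrow> w a < w b"
  shows "w = id"
proof -
  have surj: "surj w" using w by (simp add: sym_perm_def bij_is_surj)
  have step: "w (x + 1) = w x + 1" for x
  proof (rule ccontr)
    assume ne: "w (x + 1) \<noteq> w x + 1"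
    \<comment> \<open>A gap after \<open>w x\<close> would force this preimage to lie strictly
      between \<open>x\<close> and \<open>x + 1\<close>.\<close>
    obtain y where y: "w x + 1 = w y" using surj by (metis surjD)
    have "w x < w (x + 1)" by (rule mono) simp
    then have lt: "w y < w (x + 1)" "w x < w y" using ne y by linarith+
    have "x < y" "y < x + 1"
      using lt mono by (metis less_le_not_le linorder_le_less_linear order_less_le)+
    then show False by simp
  qed
  have shift: "w x = w 0 + x" for x
  proof (induction x rule: int_induct[where k = 0])
    case (step2 i)
    then show ?case using step[of "i - 1"] by simp
  qed (use step in auto)
  from sym_perm_mirror[OF w, of 0] shift[of "- 1"] have "w 0 = 0" by simp
  with shift show ?thesis by (auto simp: fun_eq_iff)
qed

text \<open>The composite of \<open>v\<close> with the inverse of \<open>w\<close> preserves the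
  order. Longest elements are later identified in this way, by their inversions alone.\<close>

lemma sym_perm_eqI:
  assumes v: "sym_perm v" and w: "sym_perm w"
    and iff: "\<And>a b. a < b \<Longrightarrow> v b < v a \<longleftrightarrow> w b < w a"
  shows "v = w"
proof -
  have s: "sym_perm (v \<circ> inv_into UNIV w)" using v w by (intro sym_perm_comp sym_perm_inv)
  have wb: "bij w" using w by (simp add: sym_perm_def)
  have "v \<circ> inv_into UNIV w = id"
  proof (rule strict_mono_sym_perm[OF s])
    fix a b :: int assume "a < b"
    obtain x y where xy: "a = w x" "b = w y" using wb by (metis bij_pointE)
    have "x \<noteq> y" using \<open>a < b\<close> xy by auto
    then have "v x < v y"
      using iff[of x y] iff[of y x] \<open>a < b\<close> xy sym_perm_inj[OF v, of x y] by (cases "x < y") auto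
    then show "(v \<circ> inv_into UNIV w) a < (v \<circ> inv_into UNIV w) b"
      using wb xy by (simp add: bij_is_inj inv_f_f)
  qed
  then show ?thesis using wb by (metis comp_assoc comp_id id_comp bij_is_inj inv_o_cancel)
qed

text \<open>Inversions come in mirror pairs; the condition on \<open>a + b\<close> selects one of each pair.\<close>

definition inversions :: "(int \<Rightarrow> int) \<Rightarrow> (int \<times> int) set" where
  "inversions w = {(a, b). a < b \<and> - 1 \<le> a + b \<and> w b < w a}"

definition ninv :: "(int \<Rightarrow> int) \<Rightarrow> nat" where
  "ninv w = card (inversions w)"

lemma inversions_id [simp]: "inversions id = {}" and ninv_id [simp]: "ninv id = 0"
proof -
  show "inversions id = {}" by (auto simp: inversions_def)
  then show "ninv id = 0" by (simp add: ninv_def)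
qed

text \<open>The mirror image of a pair with sum \<open>s\<close> has sum \<open>- 2 - s\<close>, so
  \<open>f\<close> applies the reflection and then returns to the selected representative. Only
  \<open>(d - 1, d)\<close> and its mirror image are reversed by \<open>refl_at d\<close>; away from
  them \<open>f\<close> is an involution matching the inversions of \<open>w\<close> with those of
  the product.\<close>

lemma inversions_comp_refl_at:
  assumes w: "sym_perm w" and d: "0 \<le> d" and asc: "w (d - 1) < w d"
  defines "f \<equiv> \<lambda>(a, b). if - 1 \<le> refl_at d a + refl_at d b then (refl_at d a, refl_at d b)
                 else (- 1 - refl_at d b, - 1 - refl_at d a)"
  shows "inversions (w \<circ> refl_at d) = insert (d - 1, d) (f ` inversions w)"
    and "inj_on f (inversions w)" and "(d - 1, d) \<notin> f ` inversions w"
proof -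
  let ?g = "refl_at d" and ?P = "{(a, b). a < b \<and> - 1 \<le> a + b} - {(d - 1, d)}"
  have lt: "?g a < ?g b" if "(a, b) \<in> ?P" for a b
  proof (rule ccontr)
    assume "\<not> ?g a < ?g b"
    then show False using refl_at_inverts[of a b d] that d by auto
  qed
  have m: "?g (- 1 - x) = - 1 - ?g x" for x by (rule refl_at_mirror)
  have ff: "f (f p) = p" if p: "p \<in> ?P" for p
    using p by (cases p) (auto simp: f_def m)
  have fP: "f p \<in> ?P" if p: "p \<in> ?P" for p
  proof -
    obtain a b where [simp]: "p = (a, b)" by (cases p)
    have "f p \<noteq> (d - 1, d)"
    proof
      assume e: "f p = (d - 1, d)"
      then have "p = f (d - 1, d)" using ff[OF p] by simp
      \<comment> \<open>Neither of these two pairs is increasing, so neither can be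
        \<open>p\<close>.\<close>
      also have "\<dots> = (d, d - 1) \<or> \<dots> = (- d, - 1 - d)"
        by (auto simp: f_def refl_at_def)
      finally show False using p by auto
    qed
    then show ?thesis using lt[of a b] p by (auto simp: f_def)
  qed
  have winv: "w (- 1 - x) < w (- 1 - y) \<longleftrightarrow> w y < w x" for x y
    using sym_perm_mirror[OF w] by simp
  have inv_f: "f p \<in> inversions (w \<circ> ?g) \<longleftrightarrow> p \<in> inversions w" if p: "p \<in> ?P" for p
  proof -
    obtain a b where [simp]: "p = (a, b)" by (cases p)
    show ?thesis
      using fP[OF p] p lt[of a b] by (auto simp: inversions_def f_def m winv split: if_splits)
  qed
  have sub: "inversions w \<subseteq> ?P" using asc by (auto simp: inversions_def)
  have mem: "(d - 1, d) \<in> inversions (w \<circ> ?g)"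
    using asc d by (auto simp: inversions_def refl_at_def)
  have sub2: "inversions (w \<circ> ?g) \<subseteq> insert (d - 1, d) ?P" by (auto simp: inversions_def)
  show "inversions (w \<circ> ?g) = insert (d - 1, d) (f ` inversions w)"
  proof (intro equalityI subsetI)
    fix p assume p: "p \<in> inversions (w \<circ> ?g)"
    show "p \<in> insert (d - 1, d) (f ` inversions w)"
    proof (cases "p = (d - 1, d)")
      case False
      then have P: "p \<in> ?P" using p sub2 by blast
      have "f p \<in> inversions w" using inv_f[OF fP[OF P]] ff[OF P] p by simp
      then show ?thesis using ff[OF P] by (metis image_eqI insertCI)
    qed simp
  next
    fix p assume "p \<in> insert (d - 1, d) (f ` inversions w)"
    then show "p \<in> inversions (w \<circ> ?g)" using mem sub inv_f by blast
  qed
  show "inj_on f (inversions w)" using ff sub by (intro inj_on_inverseI[of _ f]) blast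
  show "(d - 1, d) \<notin> f ` inversions w"
  proof
    assume "(d - 1, d) \<in> f ` inversions w"
    then obtain p where "p \<in> inversions w" "(d - 1, d) = f p" by (rule imageE)
    moreover have "f p \<in> ?P" using calculation sub by (intro fP) (rule subsetD)
    ultimately show False by simp
  qed
qed

lemma ninv_ascent:
  assumes "sym_perm w" "finite (inversions w)" "0 \<le> d" "w (d - 1) < w d"
  shows "finite (inversions (w \<circ> refl_at d))" "ninv (w \<circ> refl_at d) = Suc (ninv w)"
  using inversions_comp_refl_at[OF assms(1,3,4)] assms(2)
  by (simp_all add: ninv_def card_image)

lemma comp_refl_at_refl_at [simp]: "w \<circ> refl_at d \<circ> refl_at d = w"
  by (simp add: comp_assoc)

lemma refl_at_values: "refl_at d d = d - 1" "refl_at d (d - 1) = d"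
  by (auto simp: refl_at_def)

text \<open>This is \<open>ninv_ascent\<close> for \<open>w \<circ> refl_at d\<close>. Its
  finiteness hypothesis must first be pulled back along the injection \<open>f\<close> of the
  previous count.\<close>

lemma ninv_descent:
  assumes w: "sym_perm w" "finite (inversions w)" "0 \<le> d" "w d < w (d - 1)"
  shows "finite (inversions (w \<circ> refl_at d))" "ninv w = Suc (ninv (w \<circ> refl_at d))"
proof -
  show fin: "finite (inversions (w \<circ> refl_at d))"
  proof (rule ccontr)
    let ?f = "\<lambda>(a, b). if - 1 \<le> refl_at d a + refl_at d b then (refl_at d a, refl_at d b)
                 else (- 1 - refl_at d b, - 1 - refl_at d a)"
    assume inf: "infinite (inversions (w \<circ> refl_at d))"
    have s: "sym_perm (w \<circ> refl_at d)" by (intro sym_perm_comp w) simp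
    have a: "(w \<circ> refl_at d) (d - 1) < (w \<circ> refl_at d) d" using w(4) by (simp add: refl_at_values)
    from inversions_comp_refl_at[OF s w(3) a] w(2) inf show False
      by (simp only: comp_refl_at_refl_at finite_insert finite_image_iff)
  qed
  show "ninv w = Suc (ninv (w \<circ> refl_at d))"
    using ninv_ascent(2)[of "w \<circ> refl_at d" d] fin w sym_perm_comp[OF w(1) sym_perm_refl_at]
    by (simp add: refl_at_values)
qed

section \<open>Reduced words and Matsumoto's theorem\<close>

text \<open>The Coxeter matrix of type B of infinite rank, indexed by positions with the special
  node at 0.\<close>

definition bmat :: "int \<Rightarrow> int \<Rightarrow> enat" where
  "bmat d e = (if d = e then 1 else if {d, e} = {0, 1} then 4 else if \<bar>d - e\<bar> = 1 then 3 else 2)"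

lemma refl_at_eq_self: "x \<noteq> d - 1 \<Longrightarrow> x \<noteq> d \<Longrightarrow> x \<noteq> - d \<Longrightarrow> x \<noteq> - d - 1 \<Longrightarrow> refl_at d x = x"
  by (simp add: refl_at_def)

lemma refl_at_swaps: "refl_at d (d - 1) = d" "refl_at d d = d - 1" "refl_at d (- d) = - d - 1" "refl_at d (- d - 1) = - d"
  by (auto simp: refl_at_def)

lemma refl_at_commute:
  assumes "0 \<le> d" "d + 2 \<le> e"
  shows "refl_at d \<circ> refl_at e = refl_at e \<circ> refl_at d"
proof (rule ext, unfold comp_apply)
  fix x
  have fixed: "refl_at e y = y" if "y \<in> {d - 1, d, - d, - d - 1}" for y
    using that assms by (auto intro!: refl_at_eq_self)
  have fixed': "refl_at d y = y" if "y \<in> {e - 1, e, - e, - e - 1}" for y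
    using that assms by (auto intro!: refl_at_eq_self)
  consider "x \<in> {d - 1, d, - d, - d - 1}" | "x \<in> {e - 1, e, - e, - e - 1}" | "x \<notin> {d - 1, d, - d, - d - 1}" "x \<notin> {e - 1, e, - e, - e - 1}"
    by blast
  then show "refl_at d (refl_at e x) = refl_at e (refl_at d x)"
    by cases (auto simp: fixed fixed' refl_at_swaps refl_at_eq_self)
qed

lemma refl_at_braid3:
  assumes "0 < d"
  shows "refl_at d \<circ> refl_at (d + 1) \<circ> refl_at d = refl_at (d + 1) \<circ> refl_at d \<circ> refl_at (d + 1)"
proof (rule ext, unfold comp_apply)
  fix x
  consider "x = d - 1" | "x = d" | "x = d + 1" | "x = - d" | "x = - d - 1" | "x = - d - 2" 
   | "x \<notin> {d - 1, d, d + 1, - d, - d - 1, - d - 2}"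
    by blast
  then show "refl_at d (refl_at (d + 1) (refl_at d x)) = refl_at (d + 1) (refl_at d (refl_at (d + 1) x))"
    using assms by cases (simp_all add: refl_at_def)
qed

lemma refl_at_braid4:
  "refl_at 0 \<circ> refl_at 1 \<circ> refl_at 0 \<circ> refl_at 1 = refl_at 1 \<circ> refl_at 0 \<circ> refl_at 1 \<circ> refl_at 0"
proof (rule ext, unfold comp_apply)
  fix x :: int
  consider "x = - 2" | "x = - 1" | "x = 0" | "x = 1" | "x \<notin> {- 2, - 1, 0, 1}"
    by blast
  then show "refl_at 0 (refl_at 1 (refl_at 0 (refl_at 1 x))) = refl_at 1 (refl_at 0 (refl_at 1 (refl_at 0 x)))"
    by cases (simp_all add: refl_at_def)
qed
lemma bmat_2: "d + 2 \<le> e \<Longrightarrow> bmat d e = 2" "d + 2 \<le> e \<Longrightarrow> bmat e d = 2" 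
  and bmat_3: "0 < d \<Longrightarrow> bmat d (d + 1) = 3" "0 < d \<Longrightarrow> bmat (d + 1) d = 3" 
  and bmat_4: "bmat 0 1 = 4" "bmat 1 0 = 4"
  by (auto simp: bmat_def doubleton_eq_iff)

lemma alternating_2: "alternating i j 2 = [i, j]"
  and alternating_3: "alternating i j 3 = [i, j, i]"
  and alternating_4: "alternating i j 4 = [i, j, i, j]"
  by (simp_all add: eval_nat_numeral)

lemma alternating_in_lists [intro]:
  assumes "i \<in> I" "j \<in> I"
  shows "alternating i j k \<in> lists I"
  using assms by (induction i j k rule: alternating.induct) auto

lemma word_cong_refl_append:
  assumes "word_cong I R u v" "a \<in> lists I" "b \<in> lists I"
  shows "word_cong I R (a @ u @ b) (a @ v @ b)"
  using assms by (intro word_cong.append word_cong.refl)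

text \<open>The positions form any finite set of nonnegative integers, not necessarily an interval
  from 0: leaving out 0 gives type A.\<close>

locale coxeter_B =
  fixes M :: "'i coxeter" and pos :: "'i \<Rightarrow> int"
  assumes fin: "finite (index M)"
    and inj: "inj_on pos (index M)"
    and nonneg: "i \<in> index M \<Longrightarrow> 0 \<le> pos i"
    and mat: "i \<in> index M \<Longrightarrow> j \<in> index M \<Longrightarrow> mat M i j = bmat (pos i) (pos j)"
begin

abbreviation "I \<equiv> index M"

definition perm :: "'i list \<Rightarrow> int \<Rightarrow> int" where
  "perm u = foldr (\<lambda>i w. refl_at (pos i) \<circ> w) u id"

lemma perm_simps [simp]: "perm [] = id" "perm (i # u) = refl_at (pos i) \<circ> perm u"
  by (simp_all add: perm_def)

lemma perm_append: "perm (u @ v) = perm u \<circ> perm v"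
  by (induction u) (auto simp: comp_assoc)

lemma perm_snoc: "perm (u @ [i]) = perm u \<circ> refl_at (pos i)"
  by (simp add: perm_append)

lemma sym_perm_perm [simp]: "sym_perm (perm u)"
proof (induction u)
  case (Cons i u)
  then show ?case unfolding perm_simps by (intro sym_perm_comp sym_perm_refl_at)
qed (simp only: perm_simps sym_perm_id)

lemma perm_rev: "perm (rev u) \<circ> perm u = id"
proof (induction u)
  case (Cons i u)
  have "perm (rev (i # u)) \<circ> perm (i # u) = perm (rev u) \<circ> (refl_at (pos i) \<circ> refl_at (pos i)) \<circ> perm u"
    by (simp only: rev.simps perm_append perm_simps comp_assoc comp_id id_comp)
  then show ?case by (simp only: refl_at_comp_self comp_id Cons)
qed simp

section \<open>Subgroups generated by letters, and descents\<close>

definition W :: "'i set \<Rightarrow> (int \<Rightarrow> int) set" where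
  "W K = perm ` lists K"

lemma W_mono: "K \<subseteq> L \<Longrightarrow> W K \<subseteq> W L"
  unfolding W_def using lists_mono by blast

lemma W_id [simp]: "id \<in> W K"
  unfolding W_def by (rule image_eqI[of _ _ "[]"]) auto

lemma W_comp: "v \<in> W K \<Longrightarrow> w \<in> W K \<Longrightarrow> v \<circ> w \<in> W K"
proof -
  assume "v \<in> W K" "w \<in> W K"
  then obtain a b where "a \<in> lists K" "b \<in> lists K" "v = perm a" "w = perm b"
    by (auto simp: W_def)
  then show ?thesis
    unfolding W_def by (intro image_eqI[of _ _ "a @ b"]) (auto simp: perm_append)
qed

lemma W_refl_at: "i \<in> K \<Longrightarrow> refl_at (pos i) \<in> W K"
  unfolding W_def by (rule image_eqI[of _ _ "[i]"]) auto

lemma W_snoc: "w \<in> W K \<Longrightarrow> i \<in> K \<Longrightarrow> w \<circ> refl_at (pos i) \<in> W K"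
  by (intro W_comp W_refl_at)

lemma sym_perm_W: "w \<in> W K \<Longrightarrow> sym_perm w"
  by (auto simp: W_def)

lemma W_inverse:
  assumes "w \<in> W K"
  obtains v where "v \<in> W K" "v \<circ> w = id" "w \<circ> v = id"
proof -
  obtain u where u: "u \<in> lists K" "w = perm u" using assms by (auto simp: W_def)
  show thesis
  proof
    show "perm (rev u) \<in> W K" using u by (auto simp: W_def)
    show "perm (rev u) \<circ> w = id" "w \<circ> perm (rev u) = id"
      using perm_rev[of u] perm_rev[of "rev u"] u by auto
  qed
qed

text \<open>The positions \<open>x\<close> at which the line cannot be cut between \<open>x - 1\<close> and \<open>x\<close>.\<close>

definition links :: "'i set \<Rightarrow> int set" where
  "links K = {x. \<bar>x\<bar> \<in> pos ` K}"

text \<open>\<open>refl_at d\<close> with \<open>d \<ge> 0\<close> carries points only across the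
  cuts at \<open>d\<close> and \<open>- d\<close>, so no letter of \<open>K\<close> carries a point
  across an unlinked cut.\<close>

lemma W_preserves_cut:
  assumes "w \<in> W K" "K \<subseteq> I" "x \<notin> links K"
  shows "w y < x \<longleftrightarrow> y < x"
proof -
  obtain u where u: "u \<in> lists K" "w = perm u" using assms by (auto simp: W_def)
  have "perm u y < x \<longleftrightarrow> y < x" using u(1)
  proof (induction u arbitrary: y)
    case (Cons i u)
    have "i \<in> K" using Cons by simp
    then have "\<bar>x\<bar> \<noteq> pos i" "0 \<le> pos i" using assms nonneg by (auto simp: links_def)
    then have "refl_at (pos i) z < x \<longleftrightarrow> z < x" for z by (auto simp: refl_at_def)
    then show ?case using Cons by auto
  qed simp
  then show ?thesis using u by simp
qed

text \<open>Neighbours separated by an unlinked cut keep their order by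
  \<open>W_preserves_cut\<close>, linked ones at nonnegative cuts by hypothesis, and the rest by
  mirror symmetry; so \<open>w\<close> is increasing.\<close>

lemma no_descent_imp_id:
  assumes w: "w \<in> W K" and K: "K \<subseteq> I"
    and asc: "\<And>i. i \<in> K \<Longrightarrow> w (pos i - 1) < w (pos i)"
  shows "w = id"
proof -
  have s: "sym_perm w" using w by (rule sym_perm_W)
  have nn: "w (x - 1) < w x" if "0 \<le> x" for x
  proof (cases "x \<in> links K")
    case True
    then obtain i where "i \<in> K" "\<bar>x\<bar> = pos i" by (auto simp: links_def)
    then show ?thesis using asc that by simp
  next
    case False
    from W_preserves_cut[OF w K False, of "x - 1"] W_preserves_cut[OF w K False, of x]
    show ?thesis by simp
  qed
  have all: "w (x - 1) < w x" for x
  proof (cases "0 \<le> x")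
    case False
    have e: "- 1 - x = - x - 1" "- 1 - (x - 1) = - x" by simp_all
    from nn[of "- x"] False have "w (- 1 - x) < w (- 1 - (x - 1))" unfolding e by simp
    then show ?thesis by (simp only: sym_perm_mirror[OF s])
  qed (rule nn)
  have lt: "a < b \<Longrightarrow> w a < w b" for a b
  proof (induction b rule: int_gr_induct)
    case base
    then show ?case using all[of "a + 1"] by simp
  next
    case (step b)
    then show ?case using all[of "b + 1"] by simp
  qed
  show ?thesis by (rule strict_mono_sym_perm[OF s lt])
qed

lemma finite_inversions_perm:
  assumes "u \<in> lists I"
  shows "finite (inversions (perm u)) \<and> ninv (perm u) \<le> length u"
  using assms
proof (induction u rule: rev_induct)
  case (snoc i u)
  then have i: "0 \<le> pos i" and IH: "finite (inversions (perm u))" "ninv (perm u) \<le> length u"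
    using nonneg by auto
  have "perm u (pos i - 1) \<noteq> perm u (pos i)" by (simp add: sym_perm_inj)
  then consider "perm u (pos i - 1) < perm u (pos i)" | "perm u (pos i) < perm u (pos i - 1)"
    by linarith
  then have "finite (inversions (perm u \<circ> refl_at (pos i))) \<and>
      ninv (perm u \<circ> refl_at (pos i)) \<le> Suc (length u)"
  proof cases
    case 1
    with ninv_ascent[OF sym_perm_perm IH(1) i] IH(2) show ?thesis by simp
  next
    case 2
    with ninv_descent[OF sym_perm_perm IH(1) i] IH(2) show ?thesis by simp
  qed
  then show ?case by (simp only: perm_snoc length_append_singleton)
qed (simp only: perm_simps inversions_id ninv_id, simp)

lemma finite_inversions_W: "w \<in> W K \<Longrightarrow> K \<subseteq> I \<Longrightarrow> finite (inversions w)"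
  using finite_inversions_perm lists_mono by (fastforce simp: W_def)

lemma ninv_ascent_W:
  assumes "w \<in> W I" "i \<in> I" "w (pos i - 1) < w (pos i)"
  shows "ninv (w \<circ> refl_at (pos i)) = Suc (ninv w)"
  by (intro ninv_ascent(2) sym_perm_W[OF assms(1)] finite_inversions_W[OF assms(1)] nonneg assms) auto

lemma ninv_descent_W:
  assumes "w \<in> W I" "i \<in> I" "w (pos i) < w (pos i - 1)"
  shows "ninv w = Suc (ninv (w \<circ> refl_at (pos i)))"
  by (intro ninv_descent(2) sym_perm_W[OF assms(1)] finite_inversions_W[OF assms(1)] nonneg assms) auto

text \<open>Phrased with inversions so that Matsumoto's theorem can be proved before anything is
  known about the Coxeter group; agreement with \<open>reduced_expression\<close> is
  \<open>reduced_expression_iff\<close>.\<close>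

definition reduced :: "'i list \<Rightarrow> bool" where
  "reduced u \<longleftrightarrow> u \<in> lists I \<and> length u = ninv (perm u)"

lemma reduced_in_lists: "reduced u \<Longrightarrow> u \<in> lists I"
  by (simp add: reduced_def)

lemma reduced_snocI:
  assumes "reduced u" "i \<in> I" "perm u (pos i - 1) < perm u (pos i)"
  shows "reduced (u @ [i])"
  using assms ninv_ascent_W[of "perm u" i]
  by (auto simp: reduced_def perm_snoc W_def)

lemma reduced_snocD:
  assumes "reduced (u @ [i])"
  shows "reduced u" "i \<in> I" "perm (u @ [i]) (pos i) < perm (u @ [i]) (pos i - 1)"
proof -
  have u: "u \<in> lists I" and i: "i \<in> I" and len: "Suc (length u) = ninv (perm u \<circ> refl_at (pos i))"
    using assms by (auto simp: reduced_def perm_snoc)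
  have W: "perm u \<in> W I" using u by (auto simp: W_def)
  have le: "ninv (perm u) \<le> length u" using finite_inversions_perm u by blast
  have "perm u (pos i - 1) < perm u (pos i)"
  proof (rule ccontr)
    assume "\<not> ?thesis"
    then have "perm u (pos i) < perm u (pos i - 1)"
      using sym_perm_inj[OF sym_perm_perm, of u "pos i" "pos i - 1"] by linarith
    from ninv_descent_W[OF W i this] len le show False by simp
  qed
  then show "reduced u" "perm (u @ [i]) (pos i) < perm (u @ [i]) (pos i - 1)"
    using ninv_ascent_W[OF W i] len u by (auto simp: reduced_def perm_snoc refl_at_values)
  show "i \<in> I" by (rule i)
qed

text \<open>Descents are stripped off one at a time. By \<open>no_descent_imp_id\<close> a descent
  can be found inside \<open>K\<close>, so the reduced word uses letters of \<open>K\<close>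
  only.\<close>

lemma ex_reduced:
  assumes "w \<in> W K" "K \<subseteq> I"
  shows "\<exists>u\<in>lists K. reduced u \<and> perm u = w"
  using assms(1)
proof (induction "ninv w" arbitrary: w rule: less_induct)
  case less
  show ?case
  proof (cases "w = id")
    case True
    then show ?thesis by (intro bexI[of _ "[]"]) (auto simp: reduced_def)
  next
    case False
    then obtain i where i: "i \<in> K" "\<not> w (pos i - 1) < w (pos i)"
      using no_descent_imp_id[OF less.prems assms(2)] by blast
    then have d: "w (pos i) < w (pos i - 1)"
      using sym_perm_inj[OF sym_perm_W[OF less.prems], of "pos i" "pos i - 1"] by linarith
    let ?v = "w \<circ> refl_at (pos i)"
    have WI: "w \<in> W I" using less.prems W_mono[OF assms(2)] by blast
    have iI: "i \<in> I" using i assms(2) by blast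
    have v: "?v \<in> W K" using W_snoc less.prems i by blast
    have "ninv ?v < ninv w" using ninv_descent_W[OF WI iI d] by simp
    from less.hyps[OF this v] obtain u where u: "u \<in> lists K" "reduced u" "perm u = ?v" by blast
    have "reduced (u @ [i])"
      using u d iI by (intro reduced_snocI) (auto simp: refl_at_values)
    moreover have "perm (u @ [i]) = w" using u by (simp add: perm_snoc)
    ultimately show ?thesis using u i by (intro bexI[of _ "u @ [i]"]) auto
  qed
qed

lemma pos_eq_iff: "i \<in> I \<Longrightarrow> j \<in> I \<Longrightarrow> pos i = pos j \<longleftrightarrow> i = j"
  using inj by (auto dest: inj_onD)

lemma bmat_cases:
  assumes "i \<in> I" "j \<in> I" "i \<noteq> j" 
  obtains (two) "mat M i j = enat 2" "pos i + 2 \<le> pos j \<or> pos j + 2 \<le> pos i"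
    | (three) "mat M i j = enat 3" "pos i = pos j + 1 \<or> pos j = pos i + 1" "0 < pos i" "0 < pos j"
    | (four) "mat M i j = enat 4" "(pos i = 0 \<and> pos j = 1) \<or> (pos i = 1 \<and> pos j = 0)"
proof -
  have ne: "pos i \<noteq> pos j" "0 \<le> pos i" "0 \<le> pos j"
    using assms nonneg pos_eq_iff by auto
  have m: "mat M i j = bmat (pos i) (pos j)" using assms mat by auto
  have enum: "enat 2 = 2" "enat 3 = 3" "enat 4 = 4" by (simp_all add: numeral_eq_enat)
  consider "(pos i = 0 \<and> pos j = 1) \<or> (pos i = 1 \<and> pos j = 0)"
    | "pos i = pos j + 1 \<or> pos j = pos i + 1" "0 < pos i" "0 < pos j"
    | "pos i + 2 \<le> pos j \<or> pos j + 2 \<le> pos i"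
    using ne by linarith
  then show thesis
  proof cases
    case 1
    then have "bmat (pos i) (pos j) = 4" using bmat_4 by auto
    then show thesis using 1 m enum by (intro four) simp_all
  next
    case 2
    then have "bmat (pos i) (pos j) = 3" using bmat_3 by auto
    then show thesis using 2 m enum by (intro three) simp_all
  next
    case 3
    then have "bmat (pos i) (pos j) = 2" using bmat_2 by auto
    then show thesis using 3 m enum by (intro two) simp_all
  qed
qed

lemma perm_braid:
  assumes "i \<in> I" "j \<in> I" "i \<noteq> j" "mat M i j = enat k"
  shows "perm (alternating i j k) = perm (alternating j i k)"
  using assms(1-3)
proof (cases rule: bmat_cases)
  case two
  then have "k = 2" using assms by simp
  then show ?thesis
    using two(2) refl_at_commute nonneg[OF assms(1)] nonneg[OF assms(2)]
    by (auto simp: alternating_2)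
next
  case three
  then have "k = 3" using assms by simp
  then show ?thesis
    using three(2,3,4) refl_at_braid3[of "pos i"] refl_at_braid3[of "pos j"]
    by (auto simp: alternating_3 comp_assoc)
next
  case four
  then have "k = 4" using assms by simp
  then show ?thesis
    using four(2) refl_at_braid4 by (auto simp: alternating_4 comp_assoc)
qed

abbreviation "artin_cong \<equiv> word_cong I (braid_relations M)"

lemma artin_cong_braid:
  assumes "i \<in> I" "j \<in> I" "i \<noteq> j" "mat M i j = enat k"
  shows "artin_cong (alternating i j k) (alternating j i k)"
proof (rule word_cong.rel)
  show "(alternating i j k, alternating j i k) \<in> braid_relations M"
    using assms unfolding braid_relations_def by blast
qed (rule alternating_in_lists[OF assms(1,2)], rule alternating_in_lists[OF assms(2,1)])

lemma perm_artin_cong: "artin_cong u v \<Longrightarrow> perm u = perm v"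
proof (induction rule: word_cong.induct)
  case (rel u v)
  then show ?case using perm_braid unfolding braid_relations_def by blast
qed (auto simp: perm_append)

text \<open>Here \<open>z @ [i]\<close> and \<open>y @ [j]\<close> are the two alternating words of length \<open>m\<^sub>i\<^sub>j\<close>.\<close>

lemma two_descents:
  assumes w: "w \<in> W I" and ij: "i \<in> I" "j \<in> I" "i \<noteq> j"
    and di: "w (pos i) < w (pos i - 1)" and dj: "w (pos j) < w (pos j - 1)"
  shows "\<exists>x y z. reduced (x @ z @ [i]) \<and> reduced (x @ y @ [j]) \<and> perm (x @ z @ [i]) = w
           \<and> perm (x @ y @ [j]) = w \<and> artin_cong (z @ [i]) (y @ [j])"
proof -
  have key: "\<exists>x. reduced (x @ alternating i j k) \<and> reduced (x @ alternating j i k)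
       \<and> perm (x @ alternating i j k) = w \<and> perm (x @ alternating j i k) = w"
    if m: "mat M i j = enat k" for k
  proof -
    \<comment> \<open>\<open>v\<close> is \<open>w\<close> with the whole alternating word stripped
      off on the right. Reducedness of both words is then checked by reading every appended letter
      as an ascent.\<close>
    define v where "v = w \<circ> perm (rev (alternating i j k))"
    have altW: "alternating i j k \<in> lists I" "alternating j i k \<in> lists I"
      by (rule alternating_in_lists[OF ij(1,2)], rule alternating_in_lists[OF ij(2,1)])
    have v: "v \<in> W I"
      unfolding v_def using w altW by (intro W_comp) (auto simp: W_def)
    obtain x where x: "reduced x" "perm x = v" using ex_reduced[OF v] by blast
    have pw: "perm (x @ alternating i j k) = w"
    proof -
      have "perm (x @ alternating i j k) = w \<circ> (perm (rev (alternating i j k)) \<circ> perm (alternating i j k))"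
        by (simp only: perm_append x v_def comp_assoc)
      then show ?thesis by (simp add: perm_rev)
    qed
    have pw': "perm (x @ alternating j i k) = w"
      using pw perm_braid[OF ij m] by (simp add: perm_append)
    have s: "w (- 1 - x) = - 1 - w x" for x by (rule sym_perm_mirror[OF sym_perm_W[OF w]])
    have mirr: "w (- d - 1) = - 1 - w d" "w (- d) = - 1 - w (d - 1)" for d
    proof -
      have e: "- d - 1 = - 1 - d" by simp
      show "w (- d - 1) = - 1 - w d" unfolding e by (rule s)
      show "w (- d) = - 1 - w (d - 1)" using s[of "d - 1"] by simp
    qed
    from ij have "reduced (x @ alternating i j k) \<and> reduced (x @ alternating j i k)"
    proof (cases rule: bmat_cases)
      case two
      then have k: "k = 2" using m by simp
      have v_eq: "v = w \<circ> refl_at (pos j) \<circ> refl_at (pos i)"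
        by (simp add: v_def k alternating_2 comp_assoc)
      have fixed: "refl_at (pos i) (pos j) = pos j" "refl_at (pos i) (pos j - 1) = pos j - 1"
        "refl_at (pos j) (pos i) = pos i" "refl_at (pos j) (pos i - 1) = pos i - 1"
        using two(2) nonneg[OF ij(1)] nonneg[OF ij(2)] by (auto intro!: refl_at_eq_self)
      have "reduced (x @ [i] @ [j])" "reduced (x @ [j] @ [i])"
        unfolding append_assoc[symmetric]
        by (intro reduced_snocI x ij;
            use di dj in \<open>simp add: perm_append x v_eq refl_at_values fixed\<close>)+
      then show ?thesis by (simp add: k alternating_2)
    next
      case three
      then have k: "k = 3" using m by simp
      have v_eq: "v = w \<circ> refl_at (pos i) \<circ> refl_at (pos j) \<circ> refl_at (pos i)"
        by (simp add: v_def k alternating_3 comp_assoc)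
      from three(2) have "reduced (x @ [i] @ [j] @ [i]) \<and> reduced (x @ [j] @ [i] @ [j])"
      proof
        assume e: "pos i = pos j + 1"
        have vals: "refl_at (pos j) (pos j + 1) = pos j + 1" "refl_at (pos j + 1) (pos j - 1) = pos j - 1"
          "refl_at (pos j + 1) (pos j) = pos j + 1" "refl_at (pos j + 1) (pos j + 1) = pos j"
          using three(4) by (auto simp: refl_at_def)
        show ?thesis
          unfolding append_assoc[symmetric]
          by (intro conjI reduced_snocI x ij;
              use di dj in \<open>simp add: perm_append x v_eq refl_at_values e vals\<close>)
      next
        assume e: "pos j = pos i + 1"
        have vals: "refl_at (pos i) (pos i + 1) = pos i + 1" "refl_at (pos i + 1) (pos i - 1) = pos i - 1"
          "refl_at (pos i + 1) (pos i) = pos i + 1" "refl_at (pos i + 1) (pos i + 1) = pos i"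
          using three(3) by (auto simp: refl_at_def)
        show ?thesis
          unfolding append_assoc[symmetric]
          by (intro conjI reduced_snocI x ij;
              use di dj in \<open>simp add: perm_append x v_eq refl_at_values e vals\<close>)
      qed
      then show ?thesis by (simp add: k alternating_3)
    next
      case four
      then have k: "k = 4" using m by simp
      have v_eq: "v = w \<circ> refl_at (pos j) \<circ> refl_at (pos i) \<circ> refl_at (pos j) \<circ> refl_at (pos i)"
        by (simp add: v_def k alternating_4 comp_assoc)
      have vals: "refl_at 0 0 = - 1" "refl_at 0 (- 1) = 0" "refl_at 0 1 = 1" "refl_at 0 (- 2) = - 2"
        "refl_at 1 0 = 1" "refl_at 1 1 = 0" "refl_at 1 (- 1) = - 2" "refl_at 1 (- 2) = - 1"
        by (simp_all add: refl_at_def)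
      have mirr0: "w (- 1) = - 1 - w 0" "w (- 2) = - 1 - w 1"
        using mirr[of 0] mirr[of 1] by simp_all
      from four(2) have "reduced (x @ [i] @ [j] @ [i] @ [j]) \<and> reduced (x @ [j] @ [i] @ [j] @ [i])"
        unfolding append_assoc[symmetric]
        by (elim disjE conjE; intro conjI reduced_snocI x ij;
            use di dj mirr0 in \<open>simp add: perm_append x v_eq vals\<close>)
      then show ?thesis by (simp add: k alternating_4)
    qed
    with pw pw' show ?thesis by blast
  qed
  from ij show ?thesis
  proof (cases rule: bmat_cases)
    case two
    obtain x where "reduced (x @ alternating i j 2)" "reduced (x @ alternating j i 2)"
      "perm (x @ alternating i j 2) = w" "perm (x @ alternating j i 2) = w"
      using key[OF two(1)] by blast
    with word_cong.sym[OF artin_cong_braid[OF ij two(1)]] show ?thesis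
      by (intro exI[of _ x] exI[of _ "[i]"] exI[of _ "[j]"]) (simp add: alternating_2)
  next
    case three
    obtain x where "reduced (x @ alternating i j 3)" "reduced (x @ alternating j i 3)"
      "perm (x @ alternating i j 3) = w" "perm (x @ alternating j i 3) = w"
      using key[OF three(1)] by blast
    with artin_cong_braid[OF ij three(1)] show ?thesis
      by (intro exI[of _ x] exI[of _ "[j, i]"] exI[of _ "[i, j]"]) (simp add: alternating_3)
  next
    case four
    obtain x where "reduced (x @ alternating i j 4)" "reduced (x @ alternating j i 4)"
      "perm (x @ alternating i j 4) = w" "perm (x @ alternating j i 4) = w"
      using key[OF four(1)] by blast
    with word_cong.sym[OF artin_cong_braid[OF ij four(1)]] show ?thesis
      by (intro exI[of _ x] exI[of _ "[i, j, i]"] exI[of _ "[j, i, j]"]) (simp add: alternating_4)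
  qed
qed

text \<open>If the last letters \<open>i\<close> and \<open>j\<close> differ, both are right
  descents of the same element, and \<open>two_descents\<close> gives the chain \<open>u\<close>,
  \<open>x @ z @ [i]\<close>, \<open>x @ y @ [j]\<close>, \<open>v\<close>. The outer links share a
  last letter, hence follow by induction; the middle link is one braid relation.\<close>

theorem matsumoto:
  assumes "reduced u" "reduced v" "perm u = perm v"
  shows "artin_cong u v"
  using assms
proof (induction "length u" arbitrary: u v rule: less_induct)
  case less
  have len: "length u = length v" using less.prems by (simp add: reduced_def)
  show ?case
  proof (cases u rule: rev_cases)
    case Nil
    then show ?thesis using len by (auto intro: word_cong.refl)
  next
    case (snoc u' i)
    then obtain v' j where v: "v = v' @ [j]" using len by (cases v rule: rev_cases) auto
    note ru = reduced_snocD[OF less.prems(1)[unfolded snoc]]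
    note rv = reduced_snocD[OF less.prems(2)[unfolded v]]
    have step: "artin_cong (p @ [l]) (q @ [l])"
      if "reduced (p @ [l])" "reduced (q @ [l])" "perm (p @ [l]) = perm (q @ [l])"
        "length (p @ [l]) = length u" for p q l
    proof -
      have "perm p = perm q"
        using arg_cong[OF that(3), of "\<lambda>w. w \<circ> refl_at (pos l)"] by (simp only: perm_snoc comp_refl_at_refl_at)
      then have "artin_cong p q"
        using that reduced_snocD(1) by (intro less.hyps) auto
      then show ?thesis
        using reduced_snocD(2)[OF that(1)] by (intro word_cong.append word_cong.refl) auto
    qed
    have lenr: "length p = length u" if "reduced p" "perm p = perm u" for p
      using that less.prems(1) by (simp add: reduced_def)
    show ?thesis
    proof (cases "i = j")
      case True
      then show ?thesis using step less.prems snoc v by metis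
    next
      case False
      let ?w = "perm u"
      have "?w \<in> W I" using less.prems(1) by (auto simp: reduced_def W_def)
      then obtain x y z where xyz: "reduced (x @ z @ [i])" "reduced (x @ y @ [j])"
        "perm (x @ z @ [i]) = ?w" "perm (x @ y @ [j]) = ?w" "artin_cong (z @ [i]) (y @ [j])"
        using two_descents[OF _ ru(2) rv(2) False] ru(3) rv(3) snoc v less.prems(3) by metis
      have 1: "artin_cong u (x @ z @ [i])"
        using step[of u' i "x @ z"] less.prems(1) xyz(1,3) by (simp add: snoc)
      have 2: "artin_cong (x @ z @ [i]) (x @ y @ [j])"
        using xyz(5) reduced_in_lists[OF xyz(1)] by (intro word_cong.append[of _ _ x x] word_cong.refl) auto
      have 3: "artin_cong (x @ y @ [j]) v"
        using step[of "x @ y" j v'] less.prems(2,3) xyz(2,4) lenr[OF xyz(2,4)] by (simp add: v)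
      show ?thesis by (rule word_cong.trans[OF 1 word_cong.trans[OF 2 3]])
    qed
  qed
qed

section \<open>The Coxeter group and lifts of its elements\<close>

lemma coxeter_matrix: "coxeter_matrix M"
  unfolding coxeter_matrix_def
proof (intro conjI ballI impI)
  fix i j assume ij: "i \<in> I" "j \<in> I"
  show "mat M i j = mat M j i"
    using ij by (simp add: mat bmat_def insert_commute abs_minus_commute)
  show "mat M i i = 1" using ij by (simp add: mat bmat_def)
  assume "i \<noteq> j"
  with ij show "2 \<le> mat M i j"
    by (cases rule: bmat_cases) (simp_all add: numeral_eq_enat)
qed

abbreviation "coxeter_cong \<equiv> word_cong I (coxeter_relations M)"

lemma coxeter_cong_relation:
  assumes "i \<in> I" "j \<in> I" "mat M i j = enat k"
  shows "coxeter_cong (concat (replicate k [i, j])) []"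
proof (rule word_cong.rel)
  show "(concat (replicate k [i, j]), []) \<in> coxeter_relations M"
    using assms unfolding coxeter_relations_def by blast
  show "concat (replicate k [i, j]) \<in> lists I"
    using assms(1,2) by (auto split: if_splits)
qed simp

lemma coxeter_cong_square: "i \<in> I \<Longrightarrow> coxeter_cong [i, i] []"
  using coxeter_cong_relation[of i i 1] by (simp add: mat bmat_def one_enat_def)

lemma coxeter_cong_rev:
  assumes "u \<in> lists I"
  shows "coxeter_cong (rev u @ u) []"
  using assms
proof (induction u)
  case (Cons a u)
  have "coxeter_cong (rev u @ [a, a] @ u) (rev u @ [] @ u)"
    by (rule word_cong_refl_append[OF coxeter_cong_square]) (use Cons in auto)
  with Cons show ?case by (auto intro: word_cong.trans)
qed (auto intro: word_cong.refl)

text \<open>With \<open>a\<close> and \<open>b\<close> the two sides, \<open>a @ rev b\<close>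
  spells the Coxeter relator. Reading \<open>a @ rev b @ b\<close> in two ways gives
  \<open>a\<close> and \<open>b\<close>.\<close>

lemma coxeter_cong_braid:
  assumes "i \<in> I" "j \<in> I" "i \<noteq> j" "mat M i j = enat k"
  shows "coxeter_cong (alternating i j k) (alternating j i k)"
proof -
  let ?a = "alternating i j k" and ?b = "alternating j i k"
  have eq: "?a @ rev ?b = concat (replicate k [i, j])"
    using assms(1-3)
  proof (cases rule: bmat_cases)
    case two
    then have "k = 2" using assms by simp
    then show ?thesis by (simp add: eval_nat_numeral)
  next
    case three
    then have "k = 3" using assms by simp
    then show ?thesis by (simp add: eval_nat_numeral)
  next
    case four
    then have "k = 4" using assms by simp
    then show ?thesis by (simp add: eval_nat_numeral)
  qed
  have a: "?a \<in> lists I" and b: "?b \<in> lists I"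
    by (rule alternating_in_lists; fact)+
  have "coxeter_cong (?a @ (rev ?b @ ?b)) (?a @ [])"
    by (rule word_cong.append[OF word_cong.refl[OF a] coxeter_cong_rev[OF b]])
  moreover have "coxeter_cong ((?a @ rev ?b) @ ?b) ([] @ ?b)"
    unfolding eq by (intro word_cong.append word_cong.refl b coxeter_cong_relation assms)
  ultimately show ?thesis
    by (metis append_Nil append_Nil2 append_assoc word_cong.sym word_cong.trans)
qed

lemma artin_cong_imp_coxeter_cong: "artin_cong u v \<Longrightarrow> coxeter_cong u v"
proof (induction rule: word_cong.induct)
  case (rel u v)
  then show ?case using coxeter_cong_braid unfolding braid_relations_def by blast
qed (blast intro: word_cong.intros)+

lemma perm_coxeter_cong: "coxeter_cong u v \<Longrightarrow> perm u = perm v"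
proof (induction rule: word_cong.induct)
  case (rel u v)
  then obtain i j k where ij: "i \<in> I" "j \<in> I" "mat M i j = enat k"
    and u: "u = concat (replicate k [i, j])" and v: "v = []"
    unfolding coxeter_relations_def by blast
  show ?case
  proof (cases "i = j")
    case True
    then have "k = 1" using ij by (simp add: mat bmat_def one_enat_def)
    then show ?thesis using u v True by simp
  next
    case False
    have b: "perm (alternating i j k) = perm (alternating j i k)"
      by (rule perm_braid) (use ij False in auto)
    have eq: "u = alternating i j k @ rev (alternating j i k)"
      using ij(1,2) False
    proof (cases rule: bmat_cases)
      case two
      then have "k = 2" using ij by simp
      then show ?thesis using u by (simp add: eval_nat_numeral)
    next
      case three
      then have "k = 3" using ij by simp
      then show ?thesis using u by (simp add: eval_nat_numeral)
    next
      case four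
      then have "k = 4" using ij by simp
      then show ?thesis using u by (simp add: eval_nat_numeral)
    qed
    show ?thesis
      unfolding eq v perm_append b using perm_rev[of "rev (alternating j i k)"] by simp
  qed
qed (auto simp: perm_append)

text \<open>If the new letter \<open>i\<close> is a descent of the reduced word \<open>v\<close>,
  then by \<open>matsumoto\<close> \<open>v\<close> may be rewritten to end in \<open>i\<close>, and
  the two copies of \<open>i\<close> cancel.\<close>

lemma coxeter_cong_reduced:
  assumes "u \<in> lists I"
  shows "\<exists>v. reduced v \<and> coxeter_cong u v"
  using assms
proof (induction u rule: rev_induct)
  case Nil
  show ?case by (intro exI[of _ "[]"]) (auto simp: reduced_def intro: word_cong.refl)
next
  case (snoc i u)
  then have i: "i \<in> I" and "u \<in> lists I" by auto
  with snoc.IH obtain v where v: "reduced v" "coxeter_cong u v" by blast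
  have uv: "coxeter_cong (u @ [i]) (v @ [i])"
    using v(2) i by (intro word_cong.append word_cong.refl) auto
  show ?case
  proof (cases "perm v (pos i - 1) < perm v (pos i)")
    case True
    then show ?thesis using reduced_snocI[OF v(1) i] uv by blast
  next
    case False
    then have d: "perm v (pos i) < perm v (pos i - 1)"
      using sym_perm_inj[OF sym_perm_perm, of v "pos i" "pos i - 1"] by linarith
    have vI: "perm v \<in> W I" using v by (auto simp: W_def reduced_def)
    obtain t where t: "reduced t" "perm t = perm v \<circ> refl_at (pos i)"
      using ex_reduced[OF W_snoc[OF vI i]] by blast
    have "perm t (pos i - 1) < perm t (pos i)" using d by (simp add: t refl_at_values)
    then have ti: "reduced (t @ [i])" by (rule reduced_snocI[OF t(1) i])
    have "perm v = perm (t @ [i])" by (simp add: perm_snoc t)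
    then have "coxeter_cong v (t @ [i])"
      using matsumoto[OF v(1) ti] artin_cong_imp_coxeter_cong by blast
    then have 1: "coxeter_cong (v @ [i]) ((t @ [i]) @ [i])"
      using i by (intro word_cong.append word_cong.refl) auto
    have 2: "coxeter_cong (t @ [i, i]) (t @ [])"
      using reduced_in_lists[OF t(1)] by (intro word_cong.append word_cong.refl coxeter_cong_square i)
    have "coxeter_cong (u @ [i]) t"
      using word_cong.trans[OF uv word_cong.trans[OF 1]] 2 by simp
    with t show ?thesis by blast
  qed
qed

text \<open>Faithfulness of the permutation model: reduce both words by Coxeter relations, then
  apply \<open>matsumoto\<close>.\<close>

lemma coxeter_cong_iff:
  assumes "u \<in> lists I" "v \<in> lists I"
  shows "coxeter_cong u v \<longleftrightarrow> perm u = perm v"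
proof
  assume eq: "perm u = perm v"
  obtain u' v' where u': "reduced u'" "coxeter_cong u u'" and v': "reduced v'" "coxeter_cong v v'"
    using coxeter_cong_reduced assms by blast
  have "perm u' = perm v'"
    using perm_coxeter_cong[OF u'(2)] perm_coxeter_cong[OF v'(2)] eq by simp
  then have "coxeter_cong u' v'"
    using matsumoto[OF u'(1) v'(1)] artin_cong_imp_coxeter_cong by blast
  then show "coxeter_cong u v" using u' v' by (blast intro: word_cong.trans word_cong.sym)
qed (rule perm_coxeter_cong)

text \<open>The class of words in \<open>coxeter_group M\<close> belonging to a permutation. It is
  empty outside \<open>W I\<close>, whence the hypothesis of \<open>elt_eq_iff\<close>.\<close>

definition elt :: "(int \<Rightarrow> int) \<Rightarrow> 'i list set" where
  "elt w = {u \<in> lists I. perm u = w}"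

lemma coxeter_word_eq:
  assumes u: "u \<in> lists I"
  shows "coxeter_word M u = elt (perm u)"
proof -
  have "coxeter_cong u v \<longleftrightarrow> v \<in> lists I \<and> perm v = perm u" for v
    using coxeter_cong_iff[OF u, of v] word_cong_lists[of I "coxeter_relations M" u v] by metis
  then show ?thesis by (simp only: coxeter_word_def word_class_def elt_def)
qed

lemma elt_eq_iff:
  assumes "w \<in> W I"
  shows "elt w = elt w' \<longleftrightarrow> w = w'"
proof -
  obtain u where "u \<in> lists I" "perm u = w" using assms by (auto simp: W_def)
  then have "u \<in> elt w" by (simp add: elt_def)
  then show ?thesis by (auto simp: elt_def)
qed

lemma carrier_coxeter_group: "carrier (coxeter_group M) = elt ` W I"
  using coxeter_word_eq
  by (auto simp: coxeter_group_def W_def coxeter_word_def image_iff simp del: in_lists_conv_set)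

lemma elt_mult:
  assumes "v \<in> W I" "w \<in> W I"
  shows "elt v \<otimes>\<^bsub>coxeter_group M\<^esub> elt w = elt (v \<circ> w)"
proof -
  obtain a b where ab: "a \<in> lists I" "b \<in> lists I" "v = perm a" "w = perm b"
    using assms by (auto simp: W_def)
  have l: "a @ b \<in> lists I" using ab by auto
  show ?thesis
    using mult_presented_monoid[OF ab(1,2), of "coxeter_relations M"] coxeter_word_eq[OF ab(1)]
      coxeter_word_eq[OF ab(2)] coxeter_word_eq[OF l] ab
    by (simp add: coxeter_group_def coxeter_word_def perm_append)
qed

lemma one_coxeter_group: "\<one>\<^bsub>coxeter_group M\<^esub> = elt id"
  using coxeter_word_eq[of "[]"] by (simp add: coxeter_group_def coxeter_word_def)

lemma coxeter_gen_eq: "i \<in> I \<Longrightarrow> coxeter_gen M i = elt (refl_at (pos i))"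
  by (simp add: coxeter_gen_def coxeter_word_eq)

lemma coxeter_length_elt:
  assumes "w \<in> W I"
  shows "coxeter_length M (elt w) = ninv w"
  unfolding coxeter_length_def
proof (rule Least_equality)
  obtain u where "reduced u" "perm u = w" using ex_reduced[OF assms] by blast
  then show "\<exists>u\<in>lists I. coxeter_word M u = elt w \<and> length u = ninv w"
    by (intro bexI[of _ u]) (auto simp: reduced_def coxeter_word_eq)
next
  fix l assume "\<exists>u\<in>lists I. coxeter_word M u = elt w \<and> length u = l"
  then obtain u where u: "u \<in> lists I" "elt (perm u) = elt w" "length u = l"
    using coxeter_word_eq by auto
  then have "perm u = w" using elt_eq_iff[OF assms] by metis
  then show "ninv w \<le> l" using finite_inversions_perm u by blast
qed

lemma reduced_expression_iff:
  assumes "w \<in> W I"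
  shows "reduced_expression M (elt w) u \<longleftrightarrow> reduced u \<and> perm u = w"
  using elt_eq_iff[OF assms]
  unfolding reduced_expression_def coxeter_length_elt[OF assms] reduced_def
  by (metis coxeter_word_eq)

lemma artin_word_eq_iff: "u \<in> lists I \<Longrightarrow> artin_word M u = artin_word M v \<longleftrightarrow> artin_cong u v"
  by (simp add: artin_word_def word_class_eq_iff)

lemma artin_lift_elt:
  assumes "reduced u"
  shows "artin_lift M (elt (perm u)) = artin_word M u"
  unfolding artin_lift_def
proof (rule the_equality)
  have w: "perm u \<in> W I" using assms by (auto simp: W_def reduced_def)
  show "\<exists>v. reduced_expression M (elt (perm u)) v \<and> artin_word M u = artin_word M v"
    using assms reduced_expression_iff[OF w] by blast
  fix t assume "\<exists>v. reduced_expression M (elt (perm u)) v \<and> t = artin_word M v"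
  then obtain v where v: "reduced v" "perm v = perm u" "t = artin_word M v"
    using reduced_expression_iff[OF w] by blast
  then show "t = artin_word M u"
    using matsumoto[OF v(1) assms v(2)] artin_word_eq_iff[OF reduced_in_lists[OF v(1)]] by simp
qed

text \<open>By \<open>matsumoto\<close> the class of this word in the Artin monoid does not depend
  on the choice.\<close>

definition lift_word :: "(int \<Rightarrow> int) \<Rightarrow> 'i list" where
  "lift_word w = (SOME u. reduced u \<and> perm u = w)"

lemma lift_word:
  assumes "w \<in> W I"
  shows "reduced (lift_word w)" "perm (lift_word w) = w" "lift_word w \<in> lists I"
proof -
  have "\<exists>u. reduced u \<and> perm u = w" using ex_reduced[OF assms] by blast
  then have "reduced (lift_word w) \<and> perm (lift_word w) = w"
    unfolding lift_word_def by (rule someI_ex)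
  then show "reduced (lift_word w)" "perm (lift_word w) = w" "lift_word w \<in> lists I"
    using reduced_in_lists by blast+
qed

lemma artin_lift_word: "w \<in> W I \<Longrightarrow> artin_lift M (elt w) = artin_word M (lift_word w)"
  using artin_lift_elt[of "lift_word w"] lift_word by simp

text \<open>The hypothesis says that \<open>v\<close> undoes no inversion of \<open>w\<close>. Along
  a reduced word of \<open>w\<close> every letter is then an ascent both for the prefix and for
  \<open>v\<close> times the prefix, so both counts grow together.\<close>

lemma ninv_comp:
  assumes v: "v \<in> W I" and w: "w \<in> W I"
    and inv: "\<And>a b. a < b \<Longrightarrow> w b < w a \<Longrightarrow> v (w b) < v (w a)"
  shows "ninv (v \<circ> w) = ninv v + ninv w"
proof -
  obtain u where u: "reduced u" "perm u = w" using ex_reduced[OF w] by blast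
  have "ninv (v \<circ> perm u) = ninv v + ninv (perm u)"
    if "reduced u" "\<And>a b. a < b \<Longrightarrow> perm u b < perm u a \<Longrightarrow> v (perm u b) < v (perm u a)"
    using that
  proof (induction u rule: rev_induct)
    case (snoc i u)
    note r = reduced_snocD[OF snoc.prems(1)]
    let ?g = "refl_at (pos i)"
    have uI: "perm u \<in> W I" using r(1) by (auto simp: W_def reduced_def)
    have asc: "perm u (pos i - 1) < perm u (pos i)"
      using r(3) by (simp add: perm_snoc refl_at_values)
    have desc: "v (perm u (pos i - 1)) < v (perm u (pos i))"
      using snoc.prems(2)[of "pos i - 1" "pos i"] r(3) by (simp add: perm_snoc refl_at_values)
    have IH: "ninv (v \<circ> perm u) = ninv v + ninv (perm u)"
    proof (rule snoc.IH[OF r(1)])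
      fix a b assume ab: "a < b" "perm u b < perm u a"
      \<comment> \<open>The last letter reverses only this pair and its mirror image, and neither is
        an inversion of \<open>perm u\<close>. Hence the hypothesis on the longer word can be used
        at the reflected pair.\<close>
      have ni: "\<not> (a = pos i - 1 \<and> b = pos i)" using ab asc by auto
      have ni': "\<not> (a = - pos i - 1 \<and> b = - pos i)"
      proof
        assume e: "a = - pos i - 1 \<and> b = - pos i"
        then have "a = - 1 - pos i" "b = - 1 - (pos i - 1)" by auto
        with ab(2) asc show False
          by (simp only: sym_perm_mirror[OF sym_perm_perm])
      qed
      have "?g a < ?g b" using refl_at_inverts[of a b "pos i"] ab(1) ni ni' by fastforce
      then show "v (perm u b) < v (perm u a)"
        using snoc.prems(2)[of "?g a" "?g b"] ab by (simp add: perm_snoc)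
    qed
    have "ninv (v \<circ> perm u \<circ> ?g) = Suc (ninv (v \<circ> perm u))"
      by (rule ninv_ascent_W[OF W_comp[OF v uI] r(2)]) (simp add: desc)
    moreover have "ninv (perm u \<circ> ?g) = Suc (ninv (perm u))"
      by (rule ninv_ascent_W[OF uI r(2) asc])
    ultimately show ?case using IH by (simp only: perm_snoc comp_assoc add_Suc_right)
  next
    case Nil
    show ?case by (simp only: perm_simps comp_id ninv_id add_0_right)
  qed
  then show ?thesis using u inv by auto
qed

text \<open>The working criterion for concatenated words: it involves permutations only, so words
  for cables and twists never have to be written out.\<close>

lemma reduced_append:
  assumes "reduced a" "reduced b"
    and "\<And>x y. x < y \<Longrightarrow> perm b y < perm b x \<Longrightarrow> perm a (perm b y) < perm a (perm b x)"
  shows "reduced (a @ b)"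
proof -
  have "perm a \<in> W I" "perm b \<in> W I" using assms by (auto simp: W_def reduced_def)
  from ninv_comp[OF this assms(3)] assms(1,2) show ?thesis
    by (auto simp: reduced_def perm_append)
qed

section \<open>Longest elements\<close>

lemma parabolic_subgroup_eq:
  assumes K: "K \<subseteq> I"
  shows "parabolic_subgroup M K = elt ` W K"
proof -
  interpret group "coxeter_group M" by (rule group_coxeter_group[OF coxeter_matrix])
  have KI: "w \<in> W I" if "w \<in> W K" for w using that W_mono[OF K] by blast
  have gen: "coxeter_gen M i = elt (refl_at (pos i))" "refl_at (pos i) \<in> W I" if "i \<in> K" for i
    using that K coxeter_gen_eq W_refl_at by blast+
  have "x \<in> elt ` W K" if "x \<in> generate (coxeter_group M) (coxeter_gen M ` K)" for x
    using that
  proof (induction rule: generate.induct)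
    case one
    show ?case by (simp add: one_coxeter_group)
  next
    case (incl h)
    then show ?case using gen W_refl_at by auto
  next
    case (inv h)
    then obtain i where i: "i \<in> K" "h = elt (refl_at (pos i))" using gen by auto
    then have "h \<otimes>\<^bsub>coxeter_group M\<^esub> h = \<one>\<^bsub>coxeter_group M\<^esub>"
      using gen by (simp add: elt_mult one_coxeter_group)
    moreover have "h \<in> carrier (coxeter_group M)" using i gen by (auto simp: carrier_coxeter_group)
    ultimately have "inv\<^bsub>coxeter_group M\<^esub> h = h" by (intro inv_equality)
    then show ?case using i W_refl_at by auto
  next
    case (eng h1 h2)
    then obtain v w where "v \<in> W K" "w \<in> W K" "h1 = elt v" "h2 = elt w" by blast
    then show ?case using KI W_comp[of v K w] by (auto simp: elt_mult)
  qed
  moreover have "elt (perm u) \<in> generate (coxeter_group M) (coxeter_gen M ` K)" if "u \<in> lists K" for u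
    using that
  proof (induction u)
    case Nil
    have "elt id \<in> generate (coxeter_group M) (coxeter_gen M ` K)"
      using generate.one one_coxeter_group by metis
    then show ?case by (simp only: perm_simps)
  next
    case (Cons i u)
    then have i: "i \<in> K" and u: "u \<in> lists K" by auto
    have "perm u \<in> W I" using u by (intro KI) (simp add: W_def)
    then have "elt (perm (i # u)) = coxeter_gen M i \<otimes>\<^bsub>coxeter_group M\<^esub> elt (perm u)"
      using gen[OF i] by (simp add: elt_mult)
    then show ?case using Cons.IH i by (metis generate.eng generate.incl imageI)
  qed
  ultimately show ?thesis unfolding parabolic_subgroup_def W_def by blast
qed

text \<open>A cut is named by the point on its right, so the cuts separating \<open>a\<close> from
  \<open>b\<close> are the elements of \<open>{a<..b}\<close>.\<close>

definition same_block :: "'i set \<Rightarrow> int \<Rightarrow> int \<Rightarrow> bool" where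
  "same_block K a b \<longleftrightarrow> {a<..b} \<subseteq> links K"

text \<open>The elements of \<open>W K\<close> preserve the blocks of \<open>K\<close>; the longest one reverses each of them.\<close>

definition reverses_blocks :: "'i set \<Rightarrow> (int \<Rightarrow> int) \<Rightarrow> bool" where
  "reverses_blocks K w \<longleftrightarrow> (\<forall>a b. a < b \<longrightarrow> (w b < w a \<longleftrightarrow> same_block K a b))"

lemma W_block_mono:
  assumes w: "w \<in> W K" "K \<subseteq> I" and ab: "\<not> same_block K a b"
  shows "w a < w b"
proof -
  obtain x where "x \<in> {a<..b}" and x: "x \<notin> links K" using ab unfolding same_block_def by blast
  then have "w a < x" "\<not> w b < x" using W_preserves_cut[OF w x] by auto
  then show ?thesis by simp
qed

lemma links_descent:
  assumes s: "sym_perm w" and desc: "\<And>i. i \<in> K \<Longrightarrow> w (pos i) < w (pos i - 1)"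
    and x: "x \<in> links K"
  shows "w x < w (x - 1)"
proof -
  obtain i where i: "i \<in> K" "\<bar>x\<bar> = pos i" using x by (auto simp: links_def)
  show ?thesis
  proof (cases "0 \<le> x")
    case True
    then show ?thesis using desc i by simp
  next
    case False
    then have x_eq: "x = - 1 - (pos i - 1)" "x - 1 = - 1 - pos i" using i by auto
    have "w x = - 1 - w (pos i - 1)" "w (x - 1) = - 1 - w (pos i)"
      by (subst x_eq, rule sym_perm_mirror[OF s])+
    then show ?thesis using desc[OF i(1)] by simp
  qed
qed

text \<open>An element of \<open>W K\<close> with the most inversions has every letter of
  \<open>K\<close> as a descent, and neighbouring descents chain up to reverse each block.\<close>

lemma ex_reverses_blocks:
  assumes K: "K \<subseteq> I"
  shows "\<exists>w\<in>W K. reverses_blocks K w"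
proof -
  \<comment> \<open>Inserting 0 keeps the set nonempty. No cut farther than \<open>B\<close> from 0
    is linked, so all inversions of elements of \<open>W K\<close> lie in one finite box and a
    maximum exists.\<close>
  define B where "B = Max (insert 0 (pos ` I))"
  have posB: "pos i \<le> B" if "i \<in> I" for i using that fin by (auto simp: B_def)
  have B0: "0 \<le> B" using fin by (auto simp: B_def)
  have sub: "inversions w \<subseteq> {- B - 1..B} \<times> {- B - 1..B}" if w: "w \<in> W K" for w
  proof clarify
    fix a b assume ab: "(a, b) \<in> inversions w"
    have "same_block K a b"
      using W_block_mono[OF w K, of a b] ab by (force simp: inversions_def)
    then have "a + 1 \<in> links K" "b \<in> links K" using ab by (auto simp: same_block_def inversions_def)
    then have "\<bar>a + 1\<bar> \<le> B" "\<bar>b\<bar> \<le> B" using posB K by (auto simp: links_def)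
    then show "a \<in> {- B - 1..B} \<and> b \<in> {- B - 1..B}" by auto
  qed
  have bound: "ninv w < Suc (card ({- B - 1..B} \<times> {- B - 1..B}))" if "w \<in> W K" for w
    unfolding ninv_def less_Suc_eq_le using sub[OF that] by (intro card_mono) auto
  obtain w where w: "w \<in> W K" "\<And>v. v \<in> W K \<Longrightarrow> ninv v \<le> ninv w"
    using ex_has_greatest_nat[of "\<lambda>w. w \<in> W K" id ninv] bound W_id by (metis order_less_imp_le)
  have s: "sym_perm w" using w(1) by (rule sym_perm_W)
  have desc: "w (pos i) < w (pos i - 1)" if i: "i \<in> K" for i
  proof (rule ccontr)
    assume "\<not> ?thesis"
    then have "w (pos i - 1) < w (pos i)" using sym_perm_inj[OF s, of "pos i" "pos i - 1"] by linarith
    moreover have "w \<in> W I" "i \<in> I" using w(1) i K W_mono by blast+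
    ultimately have "ninv (w \<circ> refl_at (pos i)) = Suc (ninv w)" by (intro ninv_ascent_W)
    with w(2)[OF W_snoc[OF w(1) i]] show False by simp
  qed
  have "w b < w a" if "a < b" "same_block K a b" for a b
    using that
  proof (induction b rule: int_gr_induct)
    case base
    then have "a + 1 \<in> links K" by (auto simp: same_block_def)
    then show ?case using links_descent[OF s desc, of K "a + 1"] by simp
  next
    case (step b)
    then have "b + 1 \<in> links K" "same_block K a b" by (auto simp: same_block_def)
    with step links_descent[OF s desc, of K "b + 1"] show ?case by simp
  qed
  then have "reverses_blocks K w"
    using W_block_mono[OF w(1) K] unfolding reverses_blocks_def by (meson order_less_asym')
  with w(1) show ?thesis by blast
qed

lemma reverses_blocks_unique:
  assumes "sym_perm v" "sym_perm w" "reverses_blocks K v" "reverses_blocks K w"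
  shows "v = w"
  using assms by (intro sym_perm_eqI) (auto simp: reverses_blocks_def)

definition w0 :: "'i set \<Rightarrow> int \<Rightarrow> int" where
  "w0 K = (SOME w. w \<in> W K \<and> reverses_blocks K w)"

lemma w0:
  assumes "K \<subseteq> I"
  shows "w0 K \<in> W K" "reverses_blocks K (w0 K)"
  using someI_ex[of "\<lambda>w. w \<in> W K \<and> reverses_blocks K w"] ex_reverses_blocks[OF assms]
  by (auto simp: w0_def)

lemma w0_W: "K \<subseteq> I \<Longrightarrow> w0 K \<in> W I"
  using w0(1) W_mono by blast

text \<open>The order pattern alone determines the element. Membership of \<open>w\<close> in
  \<open>W K\<close> is a consequence, which is what allows \<open>w0_blow\<close> to avoid words
  altogether.\<close>

lemma w0_eqI:
  assumes "K \<subseteq> I" "sym_perm w" "reverses_blocks K w"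
  shows "w0 K = w"
  using assms(2,3) w0[OF assms(1)] by (intro reverses_blocks_unique[of _ _ K]) (rule sym_perm_W)

lemma w0_empty: "w0 {} = id"
  by (rule w0_eqI) (auto simp: reverses_blocks_def same_block_def links_def)

text \<open>Inversions of \<open>v\<close> lie inside blocks, which \<open>w0 K\<close> reverses, so
  the length of \<open>w0 K\<close> is that of \<open>v\<close> plus that of \<open>w0 K\<close>
  times the inverse of \<open>v\<close>. Hence \<open>v\<close> is no longer than
  \<open>w0 K\<close>, and equal length makes the second factor trivial.\<close>

lemma longest_eq:
  assumes K: "K \<subseteq> I"
  shows "longest M K = elt (w0 K)"
proof -
  have KI: "w \<in> W I" if "w \<in> W K" for w using that W_mono[OF K] by blast
  have len: "ninv (w0 K) = ninv (w0 K \<circ> v') + ninv v"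
    if v: "v \<in> W K" "v' \<in> W K" "v' \<circ> v = id" for v v'
  proof -
    have vv': "v' (v x) = x" for x using v(3) by (metis comp_apply id_apply)
    have "ninv ((w0 K \<circ> v') \<circ> v) = ninv (w0 K \<circ> v') + ninv v"
    proof (rule ninv_comp)
      show "w0 K \<circ> v' \<in> W I" "v \<in> W I" using v w0[OF K] by (auto intro: KI W_comp)
      fix a b assume ab: "a < b" "v b < v a"
      then have "same_block K a b" using W_block_mono[OF v(1) K, of a b] by force
      then show "(w0 K \<circ> v') (v b) < (w0 K \<circ> v') (v a)"
        using ab(1) w0(2)[OF K] by (simp add: vv' reverses_blocks_def)
    qed
    then show ?thesis by (simp only: comp_assoc v(3) comp_id)
  qed
  show ?thesis
    unfolding longest_def parabolic_subgroup_eq[OF K]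
  proof (rule the_equality, intro conjI ballI)
    show "elt (w0 K) \<in> elt ` W K" using w0[OF K] by blast
    fix x assume "x \<in> elt ` W K"
    then obtain v where v: "v \<in> W K" "x = elt v" by blast
    obtain v' where "v' \<in> W K" "v' \<circ> v = id" by (rule W_inverse[OF v(1)])
    then show "coxeter_length M x \<le> coxeter_length M (elt (w0 K))"
      using len[OF v(1)] v coxeter_length_elt KI w0(1)[OF K] by simp
  next
    fix x assume x: "x \<in> elt ` W K \<and> (\<forall>v\<in>elt ` W K. coxeter_length M v \<le> coxeter_length M x)"
    then obtain v where v: "v \<in> W K" "x = elt v" by blast
    obtain v' where v': "v' \<in> W K" "v' \<circ> v = id" "v \<circ> v' = id" by (rule W_inverse[OF v(1)])
    have "ninv (w0 K) \<le> ninv v"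
      using x v coxeter_length_elt KI w0(1)[OF K] by auto
    with len[OF v(1) v'(1,2)] have "ninv (w0 K \<circ> v') = 0" by simp
    moreover obtain u where u: "reduced u" "perm u = w0 K \<circ> v'"
      using ex_reduced[OF W_comp[OF w0(1)[OF K] v'(1)] K] by blast
    ultimately have "w0 K \<circ> v' = id" by (auto simp: reduced_def)
    then have "w0 K = v"
      by (metis comp_assoc comp_id id_comp v'(2))
    then show "x = elt (w0 K)" using v by simp
  qed
qed

lemma longest_rel_eq:
  assumes "J \<subseteq> I" "K \<subseteq> I"
  shows "longest_rel M J K = elt (w0 J \<circ> w0 K)"
  using assms by (simp add: longest_rel_def longest_eq elt_mult w0_W)

lemma artin_lift_longest:
  "K \<subseteq> I \<Longrightarrow> artin_lift M (longest M K) = artin_word M (lift_word (w0 K))"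
  by (simp add: longest_eq artin_lift_word w0_W)

lemma artin_lift_longest_rel:
  "J \<subseteq> I \<Longrightarrow> K \<subseteq> I \<Longrightarrow>
    artin_lift M (longest_rel M J K) = artin_word M (lift_word (w0 J \<circ> w0 K))"
  by (simp add: longest_rel_eq artin_lift_word w0_W W_comp)

end

section \<open>Homomorphisms given by words\<close>

text \<open>The union runs over all representatives of \<open>x\<close>, which avoids a choice; when
  \<open>h\<close> respects the braid relations all its members coincide.\<close>

definition word_hom :: "'i coxeter \<Rightarrow> ('j \<Rightarrow> 'i list) \<Rightarrow> 'j list set \<Rightarrow> 'i list set" where
  "word_hom M h x = (\<Union>u\<in>x. artin_word M (concat (map h u)))"

lemma carrier_artin_monoid: "carrier (artin_monoid M) = artin_word M ` lists (index M)"
  by (simp add: artin_monoid_def artin_word_def[abs_def])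

lemma artin_word_append:
  "u \<in> lists (index M) \<Longrightarrow> v \<in> lists (index M) \<Longrightarrow>
    artin_word M u \<otimes>\<^bsub>artin_monoid M\<^esub> artin_word M v = artin_word M (u @ v)"
  unfolding artin_monoid_def artin_word_def by (rule mult_presented_monoid)

locale artin_hom =
  fixes M' :: "'j coxeter" and M :: "'i coxeter" and h :: "'j \<Rightarrow> 'i list"
  assumes letters: "i \<in> index M' \<Longrightarrow> h i \<in> lists (index M)"
    and braid: "i \<in> index M' \<Longrightarrow> j \<in> index M' \<Longrightarrow> i \<noteq> j \<Longrightarrow> mat M' i j = enat k \<Longrightarrow>
      word_cong (index M) (braid_relations M)
        (concat (map h (alternating i j k))) (concat (map h (alternating j i k)))"
begin

lemma concat_in_lists: "u \<in> lists (index M') \<Longrightarrow> concat (map h u) \<in> lists (index M)"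
  using letters by (induction u) auto

lemma word_cong_concat:
  "word_cong (index M') (braid_relations M') u v \<Longrightarrow>
    word_cong (index M) (braid_relations M) (concat (map h u)) (concat (map h v))"
proof (induction rule: word_cong.induct)
  case (rel u v)
  then show ?case using braid unfolding braid_relations_def by blast
next
  case (refl u)
  then show ?case by (intro word_cong.refl concat_in_lists)
next
  case (append u u' v v')
  then show ?case by (simp add: word_cong.append)
qed (blast intro: word_cong.intros)+

lemma word_hom_artin_word:
  assumes u: "u \<in> lists (index M')"
  shows "word_hom M h (artin_word M' u) = artin_word M (concat (map h u))"
proof -
  have "artin_word M (concat (map h v)) = artin_word M (concat (map h u))" if "v \<in> artin_word M' u" for v
  proof -
    have "word_cong (index M') (braid_relations M') u v"
      using that by (simp add: artin_word_def word_class_def)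
    then show ?thesis
      unfolding artin_word_def
      by (intro HOL.sym[OF iffD2[OF word_class_eq_iff]] concat_in_lists u word_cong_concat)
  qed
  moreover have "u \<in> artin_word M' u"
    using u by (simp add: artin_word_def word_class_def word_cong.refl)
  ultimately show ?thesis unfolding word_hom_def by blast
qed

lemma word_hom_gen: "i \<in> index M' \<Longrightarrow> word_hom M h (artin_gen M' i) = artin_word M (h i)"
  unfolding artin_gen_def by (subst word_hom_artin_word) auto

lemma word_hom_in_monoid_hom: "word_hom M h \<in> monoid_hom (artin_monoid M') (artin_monoid M)"
proof -
  have "word_hom M h (x \<otimes>\<^bsub>artin_monoid M'\<^esub> y) =
      word_hom M h x \<otimes>\<^bsub>artin_monoid M\<^esub> word_hom M h y"
    if xy: "x \<in> carrier (artin_monoid M')" "y \<in> carrier (artin_monoid M')" for x y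
  proof -
    obtain u v where uv: "u \<in> lists (index M')" "v \<in> lists (index M')"
      and [simp]: "x = artin_word M' u" "y = artin_word M' v"
      using xy unfolding carrier_artin_monoid by blast
    have app: "u @ v \<in> lists (index M')" using uv by auto
    show ?thesis
      using word_hom_artin_word[OF uv(1)] word_hom_artin_word[OF uv(2)] word_hom_artin_word[OF app]
        artin_word_append[OF concat_in_lists[OF uv(1)] concat_in_lists[OF uv(2)]]
      by (simp add: artin_word_append[OF uv])
  qed
  moreover have "word_hom M h x \<in> carrier (artin_monoid M)"
    if x: "x \<in> carrier (artin_monoid M')" for x
  proof -
    obtain u where u: "x = artin_word M' u" "u \<in> lists (index M')"
      using x unfolding carrier_artin_monoid by (rule imageE)
    then show ?thesis
      unfolding carrier_artin_monoid
      using word_hom_artin_word[OF u(2)] concat_in_lists[OF u(2)] by (simp only: imageI)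
  qed
  moreover have "word_hom M h \<one>\<^bsub>artin_monoid M'\<^esub> = \<one>\<^bsub>artin_monoid M\<^esub>"
    using word_hom_artin_word[of "[]"] by (simp add: artin_monoid_def artin_word_def)
  ultimately show ?thesis by (auto simp: monoid_hom_def hom_def)
qed

end

section \<open>Cabling\<close>

definition cable :: "int \<Rightarrow> (int \<Rightarrow> int) \<Rightarrow> int \<Rightarrow> int" where
  "cable m w x = m * w (x div m) + x mod m"

text \<open>The permutation underlying a half twist of every ribbon in \<open>Q\<close>.\<close>

definition flip :: "int \<Rightarrow> int set \<Rightarrow> int \<Rightarrow> int" where
  "flip m Q x = (if x div m \<in> Q then m * (x div m) + (m - 1 - x mod m) else x)"

text \<open>The mirror commutes with cutting the line into ribbons: it mirrors the ribbon number and
  reverses the place inside the ribbon.\<close>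

lemma mirror_div_mod:
  fixes m x :: int
  assumes "0 < m"
  shows "(- 1 - x) div m = - 1 - x div m" "(- 1 - x) mod m = m - 1 - x mod m"
proof -
  have "- 1 - x = m * (- 1 - x div m) + (m - 1 - x mod m)"
    using mult_div_mod_eq[of m x] by (simp add: algebra_simps)
  moreover have "0 \<le> m - 1 - x mod m" "m - 1 - x mod m < m"
    using pos_mod_bound[OF assms, of x] pos_mod_sign[OF assms, of x] by linarith+
  ultimately have "(- 1 - x) div m = - 1 - x div m \<and> (- 1 - x) mod m = m - 1 - x mod m"
    by (metis (no_types) div_pos_pos_trivial add.right_neutral div_mult_self4 mod_mult_self4
        mod_pos_pos_trivial assms less_irrefl)
  then show "(- 1 - x) div m = - 1 - x div m" "(- 1 - x) mod m = m - 1 - x mod m" by simp_all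
qed

lemma div_less_imp_less:
  fixes m a b :: int
  assumes "0 < m" "a div m < b div m"
  shows "a < b"
  using assms by (meson linorder_not_less zdiv_mono1)

context
  fixes m :: int
  assumes m: "0 < m"
begin

lemma cable_div [simp]: "cable m w x div m = w (x div m)"
  and cable_mod [simp]: "cable m w x mod m = x mod m"
  using m by (simp_all add: cable_def)

lemma eq_if_div_mod: "x div m = y div m \<Longrightarrow> x mod m = y mod m \<Longrightarrow> x = y"
  by (metis mult_div_mod_eq)

lemma cable_id [simp]: "cable m id = id"
  by (auto simp: fun_eq_iff cable_def)

lemma cable_comp: "cable m (v \<circ> w) = cable m v \<circ> cable m w"
  by (auto simp: fun_eq_iff intro: eq_if_div_mod)

lemma sym_perm_cable:
  assumes w: "sym_perm w"
  shows "sym_perm (cable m w)"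
  unfolding sym_perm_def
proof (intro conjI allI)
  have "bij w" using w by (simp add: sym_perm_def)
  then have "w \<circ> inv_into UNIV w = id" "inv_into UNIV w \<circ> w = id"
    by (simp_all add: bij_is_inj bij_is_surj surj_iff[symmetric])
  then have "cable m w \<circ> cable m (inv_into UNIV w) = id" "cable m (inv_into UNIV w) \<circ> cable m w = id"
    by (simp_all add: cable_comp[symmetric])
  then show "bij (cable m w)" by (metis o_bij)
  show "cable m w (- 1 - x) = - 1 - cable m w x" for x
    by (rule eq_if_div_mod) (simp_all add: mirror_div_mod[OF m] sym_perm_mirror[OF w])
qed

lemma cable_less_iff:
  assumes w: "sym_perm w"
  shows "cable m w a < cable m w b \<longleftrightarrow>
    (if a div m = b div m then a < b else w (a div m) < w (b div m))"
proof (cases "a div m = b div m")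
  case True
  then have "a - b = a mod m - b mod m" by (metis add_diff_cancel_left mult_div_mod_eq)
  then show ?thesis using True by (simp add: cable_def) linarith
next
  case False
  then have ne: "w (a div m) \<noteq> w (b div m)" using sym_perm_inj[OF w] by simp
  show ?thesis
    using False ne div_less_imp_less[OF m, of "cable m w a" "cable m w b"]
      div_less_imp_less[OF m, of "cable m w b" "cable m w a"]
    by (auto simp: neq_iff)
qed

lemma flip_div [simp]: "flip m Q x div m = x div m"
  and flip_mod: "flip m Q x mod m = (if x div m \<in> Q then m - 1 - x mod m else x mod m)"
proof -
  have "0 \<le> m - 1 - x mod m" "m - 1 - x mod m < m"
    using pos_mod_bound[OF m, of x] pos_mod_sign[OF m, of x] by linarith+
  then show "flip m Q x div m = x div m"
    "flip m Q x mod m = (if x div m \<in> Q then m - 1 - x mod m else x mod m)"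
    using m by (simp_all add: flip_def)
qed

lemma flip_flip [simp]: "flip m Q (flip m Q x) = x"
  by (rule eq_if_div_mod) (simp_all add: flip_mod)

lemma flip_comp_self [simp]: "flip m Q \<circ> flip m Q = id"
  by (auto simp: fun_eq_iff)

lemma flip_empty [simp]: "flip m {} = id"
  by (auto simp: fun_eq_iff flip_def)

lemma flip_comp: "Q \<inter> R = {} \<Longrightarrow> flip m Q \<circ> flip m R = flip m (Q \<union> R)"
  unfolding fun_eq_iff comp_apply by (intro allI; rule eq_if_div_mod) (auto simp: flip_mod)

text \<open>Half twists slide through crossings: twisting a ribbon after it has moved is twisting
  its preimage before.\<close>

lemma flip_cable: "flip m Q \<circ> cable m w = cable m w \<circ> flip m (w -` Q)"
  unfolding fun_eq_iff comp_apply by (intro allI; rule eq_if_div_mod) (auto simp: flip_mod)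

lemma sym_perm_flip:
  assumes "\<And>q. q \<in> Q \<Longrightarrow> - 1 - q \<in> Q"
  shows "sym_perm (flip m Q)"
proof -
  have [simp]: "- 1 - q \<in> Q \<longleftrightarrow> q \<in> Q" for q
    using assms[of q] assms[of "- 1 - q"] by auto
  have "flip m Q (- 1 - x) = - 1 - flip m Q x" for x
    by (rule eq_if_div_mod; simp add: mirror_div_mod[OF m] flip_mod)
  then show ?thesis using o_bij[OF flip_comp_self flip_comp_self] by (simp add: sym_perm_def)
qed

lemma flip_less_iff:
  "flip m Q a < flip m Q b \<longleftrightarrow>
    (if a div m = b div m \<and> a div m \<in> Q then b < a else a < b)"
proof (cases "a div m = b div m")
  case True
  then have "a - b = a mod m - b mod m" by (metis add_diff_cancel_left mult_div_mod_eq)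
  then show ?thesis using True by (simp add: flip_def) linarith
next
  case False
  then show ?thesis
    using div_less_imp_less[OF m, of "flip m Q a" "flip m Q b"] div_less_imp_less[OF m, of a b]
      div_less_imp_less[OF m, of "flip m Q b" "flip m Q a"] div_less_imp_less[OF m, of b a]
    by (cases "a div m < b div m") auto
qed

end

lemma div_bounds:
  fixes m x :: int
  assumes "0 < m"
  shows "m * (x div m) \<le> x" "x < m * (x div m + 1)"
  using mult_div_mod_eq[of m x] pos_mod_bound[OF assms, of x] pos_mod_sign[OF assms, of x]
  unfolding distrib_left by linarith+

section \<open>Braid words and single generators in the permutation model\<close>

lemma (in coxeter_B) reduced_Nil: "reduced []"
  by (simp add: reduced_def)

text \<open>Both sides of a braid relation are reduced, so their cables can be compared by
  \<open>matsumoto\<close>.\<close>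

lemma (in coxeter_B) reduced_alternating:
  assumes ij: "i \<in> I" "j \<in> I" "i \<noteq> j" and k: "mat M i j = enat k"
  shows "reduced (alternating i j k)"
  using ij
proof (cases rule: bmat_cases)
  case two
  then have k2: "k = 2" using k by simp
  have fixed: "refl_at (pos i) (pos j) = pos j" "refl_at (pos i) (pos j - 1) = pos j - 1"
    using two(2) nonneg[OF ij(1)] nonneg[OF ij(2)] by (auto intro!: refl_at_eq_self)
  have "reduced (([] @ [i]) @ [j])"
    by (intro reduced_snocI reduced_Nil ij) (simp_all add: perm_append fixed)
  then show ?thesis by (simp add: k2 alternating_2)
next
  case three
  then have k3: "k = 3" using k by simp
  have "reduced ((([] @ [i]) @ [j]) @ [i])"
    using three(2)
  proof
    assume e: "pos i = pos j + 1"
    have vals: "refl_at (pos j) (pos j + 1) = pos j + 1" "refl_at (pos j + 1) (pos j - 1) = pos j - 1"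
      "refl_at (pos j + 1) (pos j) = pos j + 1" "refl_at (pos j + 1) (pos j + 1) = pos j"
      using three(4) by (auto simp: refl_at_def)
    show ?thesis
      by (intro reduced_snocI reduced_Nil ij) (simp_all add: perm_append refl_at_values e vals)
  next
    assume e: "pos j = pos i + 1"
    have vals: "refl_at (pos i) (pos i + 1) = pos i + 1" "refl_at (pos i + 1) (pos i - 1) = pos i - 1"
      "refl_at (pos i + 1) (pos i) = pos i + 1" "refl_at (pos i + 1) (pos i + 1) = pos i"
      using three(3) by (auto simp: refl_at_def)
    show ?thesis
      by (intro reduced_snocI reduced_Nil ij) (simp_all add: perm_append refl_at_values e vals)
  qed
  then show ?thesis by (simp add: k3 alternating_3)
next
  case four
  then have k4: "k = 4" using k by simp
  have vals: "refl_at 0 0 = - 1" "refl_at 0 (- 1) = 0" "refl_at 0 1 = 1" "refl_at 0 (- 2) = - 2"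
    "refl_at 1 0 = 1" "refl_at 1 1 = 0" "refl_at 1 (- 1) = - 2" "refl_at 1 (- 2) = - 1"
    by (simp_all add: refl_at_def)
  have "reduced (((([] @ [i]) @ [j]) @ [i]) @ [j])"
    using four(2)
    by (elim disjE conjE; intro reduced_snocI reduced_Nil ij; simp add: perm_append vals)
  then show ?thesis by (simp add: k4 alternating_4)
qed

lemma (in coxeter_B) w0_singleton:
  assumes i: "i \<in> I"
  shows "w0 {i} = refl_at (pos i)"
proof (rule w0_eqI)
  show "reverses_blocks {i} (refl_at (pos i))"
    unfolding reverses_blocks_def
  proof (intro allI impI iffI)
    fix a b assume ab: "a < b" "refl_at (pos i) b < refl_at (pos i) a"
    then have "(a = pos i - 1 \<and> b = pos i) \<or> (a = - pos i - 1 \<and> b = - pos i)"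
      by (intro refl_at_inverts) auto
    then show "same_block {i} a b" using nonneg[OF i] by (auto simp: same_block_def links_def)
  next
    fix a b assume ab: "a < b" "same_block {i} a b"
    have l: "\<bar>x\<bar> = pos i" if "a < x" "x \<le> b" for x
      using ab(2) that by (auto simp: same_block_def links_def)
    have "b = a + 1"
    proof (rule ccontr)
      assume "b \<noteq> a + 1"
      with ab(1) l[of "a + 1"] l[of "a + 2"] show False by presburger
    qed
    moreover have "\<bar>b\<bar> = pos i" using l ab(1) by simp
    ultimately show "refl_at (pos i) b < refl_at (pos i) a" by (auto simp: refl_at_def)
  qed
qed (use i in auto)

text \<open>A position \<open>m * d\<close> exchanges the last line of ribbon \<open>d - 1\<close>
  with the first line of ribbon \<open>d\<close>, and is available exactly if the ribbons themselves
  may cross there. Every other position in range acts inside a ribbon and is always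
  available.\<close>

locale cabling = S: coxeter_B M' pos' + T: coxeter_B M pos
  for M' :: "'j coxeter" and pos' :: "'j \<Rightarrow> int" and M :: "'i coxeter" and pos :: "'i \<Rightarrow> int" +
  fixes m n :: int
  assumes m: "0 < m"
    and pos'_less: "i \<in> index M' \<Longrightarrow> pos' i < n"
    and pos_image: "pos ` index M = {x. 0 \<le> x \<and> x < m * n \<and> (m dvd x \<longrightarrow> x div m \<in> pos' ` index M')}"
begin

abbreviation "I' \<equiv> index M'"
abbreviation "I \<equiv> index M"

text \<open>For a mirror symmetric set \<open>Q\<close> of ribbons that contains those moved by \<open>L\<close>, the
  indices of the lines inside the ribbons of \<open>Q\<close> and of the crossings of ribbons in \<open>L\<close>.\<close>

definition blow :: "int set \<Rightarrow> 'j set \<Rightarrow> 'i set" where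
  "blow Q L = {j \<in> I. if m dvd pos j then pos j div m \<in> pos' ` L else pos j div m \<in> Q}"

definition admissible :: "int set \<Rightarrow> 'j set \<Rightarrow> bool" where
  "admissible Q L \<longleftrightarrow> L \<subseteq> I' \<and> Q \<subseteq> {- n..<n} \<and> (\<forall>q\<in>Q. - 1 - q \<in> Q) \<and>
     (\<forall>i\<in>L. pos' i \<in> Q \<and> pos' i - 1 \<in> Q)"

lemma blow_subset: "blow Q L \<subseteq> I"
  by (auto simp: blow_def)

lemma admissible_mirror:
  assumes "admissible Q L"
  shows "- 1 - q \<in> Q \<longleftrightarrow> q \<in> Q"
proof -
  have *: "- 1 - r \<in> Q" if "r \<in> Q" for r using assms that by (simp add: admissible_def)
  from *[of q] *[of "- 1 - q"] show ?thesis by auto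
qed

lemma sym_perm_flip_admissible: "admissible Q L \<Longrightarrow> sym_perm (flip m Q)"
  using m by (intro sym_perm_flip) (auto simp: admissible_def)

lemma pos_blow:
  assumes "admissible Q L"
  shows "x \<in> pos ` blow Q L \<longleftrightarrow> 0 \<le> x \<and> (if m dvd x then x div m \<in> pos' ` L else x div m \<in> Q)"
proof -
  have "x < m * n" if "0 \<le> x" "if m dvd x then x div m \<in> pos' ` L else x div m \<in> Q"
  proof -
    have "x div m < n"
      using that assms pos'_less by (auto simp: admissible_def split: if_splits)
    then have "m * (x div m + 1) \<le> m * n" using m by (intro mult_left_mono) auto
    then show ?thesis using div_bounds[OF m, of x] by linarith
  qed
  note bound = this
  have "x \<in> pos ` blow Q L \<longleftrightarrow> x \<in> pos ` I \<and> (if m dvd x then x div m \<in> pos' ` L else x div m \<in> Q)"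
    by (auto simp: blow_def)
  also have "x \<in> pos ` I \<longleftrightarrow> 0 \<le> x \<and> x < m * n \<and> (m dvd x \<longrightarrow> x div m \<in> pos' ` I')"
    unfolding pos_image by simp
  finally show ?thesis
    using bound assms by (cases "m dvd x") (auto simp: admissible_def)
qed

text \<open>Cuts are mirrored by \<open>x \<mapsto> - x\<close> but ribbons by
  \<open>q \<mapsto> - 1 - q\<close>; the two agree on cuts inside ribbons by rounding, and cuts
  between ribbons scale by \<open>m\<close>.\<close>

lemma links_blow:
  assumes adm: "admissible Q L"
  shows "x \<in> T.links (blow Q L) \<longleftrightarrow> (if m dvd x then x div m \<in> S.links L else x div m \<in> Q)"
proof (cases "0 \<le> x")
  case True
  then have "0 \<le> x div m" using m by (simp add: pos_imp_zdiv_nonneg_iff)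
  then show ?thesis using True by (auto simp: T.links_def S.links_def pos_blow[OF adm])
next
  case False
  show ?thesis
  proof (cases "m dvd x")
    case True
    then obtain y where x: "x = m * y" by blast
    have abs_x: "\<bar>x\<bar> = m * \<bar>y\<bar>" using x m by (simp add: abs_mult)
    have "\<bar>x\<bar> \<in> pos ` blow Q L \<longleftrightarrow> \<bar>y\<bar> \<in> pos' ` L"
      unfolding abs_x pos_blow[OF adm] using m by simp
    then show ?thesis using x m by (simp add: T.links_def S.links_def)
  next
    case nd: False
    \<comment> \<open>As \<open>x\<close> is not a multiple of \<open>m\<close>,
      \<open>x - 1\<close> lies in the same ribbon as \<open>x\<close>, and \<open>- x\<close> is
      the mirror image of \<open>x - 1\<close>.\<close>
    have "(- x) div m = - 1 - x div m"
      using mirror_div_mod(1)[OF m, of "x - 1"] nd m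
      by (simp add: zdiv_zminus1_eq_if dvd_eq_mod_eq_0)
    then show ?thesis
      using False nd admissible_mirror[OF adm, of "x div m"] by (simp add: T.links_def pos_blow[OF adm])
  qed
qed

text \<open>Inside one ribbon no cut is a multiple of \<open>m\<close>. Across ribbons the multiples
  of \<open>m\<close> reproduce the cuts of \<open>L\<close>, and admissibility makes all cuts
  inside the ribbons passed linked as well.\<close>

lemma same_block_blow:
  assumes adm: "admissible Q L" and ab: "a < b"
  shows "T.same_block (blow Q L) a b \<longleftrightarrow>
    (if a div m = b div m then a div m \<in> Q else S.same_block L (a div m) (b div m))"
proof -
  define p q where "p = a div m" and "q = b div m"
  have a: "m * p \<le> a" "a < m * (p + 1)" and b: "m * q \<le> b" "b < m * (q + 1)"
    unfolding p_def q_def by (rule div_bounds[OF m])+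
  have pq: "p \<le> q" using ab m by (simp add: p_def q_def zdiv_mono1)
  have "T.same_block (blow Q L) a b \<longleftrightarrow> (if p = q then p \<in> Q else S.same_block L p q)"
  proof (cases "p = q")
    case True
    have y: "y div m = p \<and> \<not> m dvd y" if y: "a < y" "y \<le> b" for y
    proof
      show d: "y div m = p"
        using zdiv_mono1[of a y m] zdiv_mono1[of y b m] m y True by (simp add: p_def q_def)
      show "\<not> m dvd y"
      proof
        assume "m dvd y"
        then have "y = m * p" using d by (metis dvd_mult_div_cancel)
        then show False using a y by simp
      qed
    qed
    show ?thesis
      using True y ab by (auto simp: T.same_block_def subset_iff links_blow[OF adm])
  next
    case False
    then have lt: "p < q" using pq by simp
    show ?thesis
    proof
      assume B: "T.same_block (blow Q L) a b"
      have "S.same_block L p q"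
        unfolding S.same_block_def
      proof
        fix x assume x: "x \<in> {p<..q}"
        have "m * (p + 1) \<le> m * x" "m * x \<le> m * q" using x m by (auto intro: mult_left_mono)
        then have "m * x \<in> {a<..b}" using a b by auto
        then have "m * x \<in> T.links (blow Q L)" using B by (auto simp: T.same_block_def)
        then show "x \<in> S.links L" using m by (simp add: links_blow[OF adm])
      qed
      then show "if p = q then p \<in> Q else S.same_block L p q" using False by simp
    next
      assume "if p = q then p \<in> Q else S.same_block L p q"
      then have SB: "x \<in> S.links L" if "p < x" "x \<le> q" for x
        using that False by (auto simp: S.same_block_def)
      \<comment> \<open>A linked cut of \<open>L\<close> puts the ribbons on both sides of it into
        \<open>Q\<close>; for a negative cut this uses the mirror symmetry of
        \<open>Q\<close>.\<close>
      have inQ: "x \<in> Q \<and> x - 1 \<in> Q" if x: "p < x" "x \<le> q" for x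
      proof -
        obtain i where i: "i \<in> L" "\<bar>x\<bar> = pos' i" using SB[OF x] by (auto simp: S.links_def)
        then have Q: "pos' i \<in> Q" "pos' i - 1 \<in> Q" using adm by (auto simp: admissible_def)
        show ?thesis
        proof (cases "0 \<le> x")
          case False
          then have "x = - 1 - (pos' i - 1)" "x - 1 = - 1 - pos' i" using i by auto
          then show ?thesis using Q admissible_mirror[OF adm] by metis
        qed (use Q i in auto)
      qed
      show "T.same_block (blow Q L) a b"
        unfolding T.same_block_def
      proof
        fix y assume y: "y \<in> {a<..b}"
        have d: "p \<le> y div m" "y div m \<le> q"
          using zdiv_mono1[of a y m] zdiv_mono1[of y b m] m y by (auto simp: p_def q_def)
        show "y \<in> T.links (blow Q L)"
        proof (cases "m dvd y")
          case True
          have "y div m \<noteq> p"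
          proof
            assume "y div m = p"
            then have "y = m * p" using True by (metis dvd_mult_div_cancel)
            then show False using a y by simp
          qed
          then show ?thesis using True d SB[of "y div m"] by (simp add: links_blow[OF adm])
        next
          case nd: False
          have "y div m \<in> Q"
          proof (cases "y div m = p")
            case True
            then show ?thesis using inQ[of "p + 1"] lt by simp
          qed (use inQ[of "y div m"] d in simp)
          then show ?thesis using nd by (simp add: links_blow[OF adm])
        qed
      qed
    qed
  qed
  then show ?thesis by (simp only: p_def q_def)
qed

lemma flip_reverses_blocks:
  assumes adm: "admissible Q L" and w: "sym_perm w" "S.reverses_blocks L w"
  shows "T.reverses_blocks (blow Q L) (cable m w \<circ> flip m Q)"
  unfolding T.reverses_blocks_def
proof (intro allI impI)
  fix a b :: int assume ab: "a < b"
  show "(cable m w \<circ> flip m Q) b < (cable m w \<circ> flip m Q) a \<longleftrightarrow> T.same_block (blow Q L) a b"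
  proof (cases "a div m = b div m")
    case True
    then show ?thesis
      using ab by (simp add: same_block_blow[OF adm ab] cable_less_iff[OF m w(1)] flip_less_iff m)
  next
    case False
    have "a div m < b div m" using zdiv_mono1[of a b m] ab m False by simp
    then show ?thesis
      using w(2) False
      by (simp add: same_block_blow[OF adm ab] cable_less_iff[OF m w(1)] m S.reverses_blocks_def eq_commute)
  qed
qed

text \<open>Both sides have the same order pattern: lines within a ribbon of \<open>Q\<close> are
  reversed by the flip, lines of different ribbons as \<open>S.w0 L\<close> reverses the
  ribbons.\<close>

lemma w0_blow:
  assumes adm: "admissible Q L"
  shows "T.w0 (blow Q L) = cable m (S.w0 L) \<circ> flip m Q"
proof (rule T.w0_eqI[OF blow_subset])
  have L: "L \<subseteq> I'" using adm by (simp add: admissible_def)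
  have s: "sym_perm (S.w0 L)" using S.w0(1)[OF L] by (rule S.sym_perm_W)
  show "sym_perm (cable m (S.w0 L) \<circ> flip m Q)"
    by (intro sym_perm_comp sym_perm_cable m s sym_perm_flip_admissible[OF adm])
  show "T.reverses_blocks (blow Q L) (cable m (S.w0 L) \<circ> flip m Q)"
    by (rule flip_reverses_blocks[OF adm s S.w0(2)[OF L]])
qed

lemma W_preserves_ribbons:
  assumes adm: "admissible Q L" and w: "w \<in> S.W L"
  shows "w q \<in> Q \<longleftrightarrow> q \<in> Q"
proof -
  obtain u where u: "u \<in> lists L" "w = S.perm u" using w by (auto simp: S.W_def)
  have "S.perm u q \<in> Q \<longleftrightarrow> q \<in> Q"
    using u(1)
  proof (induction u arbitrary: q)
    case (Cons i u)
    then have Q: "pos' i \<in> Q" "pos' i - 1 \<in> Q" using adm by (auto simp: admissible_def)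
    then have "- 1 - pos' i \<in> Q" "- 1 - (pos' i - 1) \<in> Q" using admissible_mirror[OF adm] by blast+
    moreover have "- 1 - pos' i = - pos' i - 1" "- 1 - (pos' i - 1) = - pos' i" by simp_all
    ultimately have "- pos' i - 1 \<in> Q" "- pos' i \<in> Q" by metis+
    then have "refl_at (pos' i) r \<in> Q \<longleftrightarrow> r \<in> Q" for r using Q by (auto simp: refl_at_def)
    then show ?case using Cons.IH by simp
  qed simp
  then show ?thesis using u by simp
qed

text \<open>Both factors reverse the lines inside each ribbon of \<open>Q\<close>, and these reversals cancel.\<close>

lemma w0_blow_comp:
  assumes "admissible Q L1" and adm: "admissible Q L2"
  shows "T.w0 (blow Q L1) \<circ> T.w0 (blow Q L2) = cable m (S.w0 L1 \<circ> S.w0 L2)"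
proof -
  have L: "L2 \<subseteq> I'" using adm by (simp add: admissible_def)
  have "S.w0 L2 -` Q = Q" using W_preserves_ribbons[OF adm S.w0(1)[OF L]] by auto
  then have "flip m Q \<circ> (cable m (S.w0 L2) \<circ> flip m Q) = cable m (S.w0 L2)"
    using flip_cable[OF m, of Q "S.w0 L2"] by (simp add: comp_assoc[symmetric] m)
      (simp add: comp_assoc m)
  then show ?thesis
    using m by (simp add: w0_blow assms cable_comp comp_assoc)
qed

text \<open>With these ribbons as \<open>Q\<close>, \<open>blow\<close> gives the interval attached
  to the generator \<open>i\<close>, with or without its crossing position according as
  \<open>L\<close> is \<open>{i}\<close> or empty.\<close>

definition near :: "'j \<Rightarrow> int set" where
  "near i = {pos' i - 1, pos' i, - pos' i, - pos' i - 1}"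

lemma admissible_near:
  assumes "i \<in> I'" "L \<subseteq> {i}"
  shows "admissible (near i) L"
  using assms S.nonneg[of i] pos'_less[of i] by (auto simp: admissible_def near_def)

text \<open>The ribbon crossing is the element prescribed in (a) and (c), a case of
  \<open>w0_blow_comp\<close>. It also shows that the cable of a generator lies in
  \<open>T.W I\<close>.\<close>

lemma cable_gen:
  assumes i: "i \<in> I'"
  shows "cable m (refl_at (pos' i)) = T.w0 (blow (near i) {}) \<circ> T.w0 (blow (near i) {i})"
  using w0_blow_comp[OF admissible_near[OF i] admissible_near[OF i], of "{}" "{i}"]
  by (simp add: S.w0_empty S.w0_singleton[OF i])

lemma cable_gen_W: "i \<in> I' \<Longrightarrow> cable m (refl_at (pos' i)) \<in> T.W I"
  by (simp only: cable_gen) (intro T.W_comp T.w0_W blow_subset)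

lemma cable_W:
  assumes "w \<in> S.W I'"
  shows "cable m w \<in> T.W I"
proof -
  obtain u where u: "u \<in> lists I'" "w = S.perm u" using assms by (auto simp: S.W_def)
  have "cable m (S.perm u) \<in> T.W I" using u(1)
  proof (induction u)
    case Nil
    show ?case using m by (simp only: S.perm_simps cable_id T.W_id)
  next
    case (Cons i u)
    then have "cable m (refl_at (pos' i) \<circ> S.perm u) \<in> T.W I"
      unfolding cable_comp[OF m] by (intro T.W_comp cable_gen_W) auto
    then show ?case by (simp only: S.perm_simps)
  qed
  with u show ?thesis by simp
qed

section \<open>Ribbon crossings as words: the homomorphisms of (a) and (c)\<close>

definition braid_word :: "'j \<Rightarrow> 'i list" where
  "braid_word i = T.lift_word (cable m (refl_at (pos' i)))"

lemma braid_word: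
  assumes "i \<in> I'"
  shows "T.reduced (braid_word i)" "T.perm (braid_word i) = cable m (refl_at (pos' i))"
    "braid_word i \<in> lists I"
  unfolding braid_word_def using T.lift_word[OF cable_gen_W[OF assms]] by auto

lemma cable_gen_inverts:
  assumes "i \<in> I'" "a < b" "cable m (refl_at (pos' i)) b < cable m (refl_at (pos' i)) a"
  shows "(a div m = pos' i - 1 \<and> b div m = pos' i) \<or> (a div m = - pos' i - 1 \<and> b div m = - pos' i)"
proof -
  have lt: "a div m \<noteq> b div m" "refl_at (pos' i) (b div m) < refl_at (pos' i) (a div m)"
    using assms(2,3) by (auto simp: cable_less_iff[OF m] split: if_splits)
  moreover have "a div m \<le> b div m" using assms(2) m by (simp add: zdiv_mono1)
  ultimately show ?thesis by (intro refl_at_inverts) auto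
qed

text \<open>The crossing for \<open>i\<close> inverts only lines of the two ribbons adjacent at
  \<open>pos' i\<close>, or of their mirror images. A reduced word has an ascent there before the
  letter \<open>i\<close>, so no earlier inversion is undone.\<close>

lemma concat_braid_word:
  assumes "S.reduced u"
  shows "T.reduced (concat (map braid_word u)) \<and>
    T.perm (concat (map braid_word u)) = cable m (S.perm u)"
  using assms
proof (induction u rule: rev_induct)
  case Nil
  show ?case
    by (simp only: list.map concat.simps S.perm_simps T.perm_simps cable_id[OF m] T.reduced_Nil)
next
  case (snoc i u)
  note r = S.reduced_snocD[OF snoc.prems]
  note b = braid_word[OF r(2)]
  let ?c = "concat (map braid_word u)"
  have IH: "T.reduced ?c" "T.perm ?c = cable m (S.perm u)" using snoc.IH[OF r(1)] by auto
  have asc: "S.perm u (pos' i - 1) < S.perm u (pos' i)"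
    using r(3) by (simp add: S.perm_snoc refl_at_values)
  have "S.perm u (- 1 - pos' i) < S.perm u (- 1 - (pos' i - 1))"
    unfolding sym_perm_mirror[OF S.sym_perm_perm] using asc by simp
  moreover have "- 1 - pos' i = - pos' i - 1" "- 1 - (pos' i - 1) = - pos' i" by simp_all
  ultimately have asc': "S.perm u (- pos' i - 1) < S.perm u (- pos' i)" by metis
  have "T.reduced (?c @ braid_word i)"
  proof (rule T.reduced_append[OF IH(1) b(1)])
    fix x y :: int
    assume xy: "x < y" "T.perm (braid_word i) y < T.perm (braid_word i) x"
    from cable_gen_inverts[OF r(2) xy[unfolded b(2)]]
    show "T.perm ?c (T.perm (braid_word i) y) < T.perm ?c (T.perm (braid_word i) x)"
      using asc asc' sym_perm_inj[OF S.sym_perm_perm, of u]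
      by (auto simp: IH(2) b(2) cable_less_iff[OF m S.sym_perm_perm] m refl_at_swaps)
  qed
  moreover have "T.perm (?c @ braid_word i) = cable m (S.perm (u @ [i]))"
    by (simp only: T.perm_append IH(2) b(2) S.perm_snoc cable_comp[OF m])
  ultimately show ?case by simp
qed

lemma concat_braid_word_perm:
  assumes "u \<in> lists I'"
  shows "T.perm (concat (map braid_word u)) = cable m (S.perm u)"
proof -
  have "T.perm (concat (map braid_word u)) x = cable m (S.perm u) x" for x
    using assms
    by (induction u arbitrary: x) (simp_all add: T.perm_append braid_word(2) cable_comp[OF m] m)
  then show ?thesis by (simp add: fun_eq_iff)
qed

lemma braid_word_braid:
  assumes "i \<in> I'" "j \<in> I'" "i \<noteq> j" "mat M' i j = enat k"
  shows "T.artin_cong (concat (map braid_word (alternating i j k)))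
    (concat (map braid_word (alternating j i k)))"
proof -
  have "mat M' j i = enat k"
    using S.coxeter_matrix assms by (auto simp: coxeter_matrix_def)
  then have "S.reduced (alternating i j k)" "S.reduced (alternating j i k)"
    using assms by (auto intro: S.reduced_alternating)
  from this[THEN concat_braid_word] S.perm_braid[OF assms] show ?thesis
    by (auto intro: T.matsumoto)
qed

sublocale braid: artin_hom M' M braid_word
  by unfold_locales (use braid_word(3) braid_word_braid in auto)

text \<open>Images of reduced words are reduced, so lifts go to lifts; an arbitrary homomorphism of
  Artin monoids need not have this property.\<close>

lemma braid_hom_lift:
  assumes "w \<in> S.W I'"
  shows "word_hom M braid_word (artin_lift M' (S.elt w)) = artin_lift M (T.elt (cable m w))"
proof -
  let ?u = "S.lift_word w"
  note u = S.lift_word[OF assms]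
  note c = concat_braid_word[OF u(1)]
  show ?thesis
    using T.artin_lift_elt[OF conjunct1[OF c]] c u
    by (simp add: S.artin_lift_word[OF assms] braid.word_hom_artin_word)
qed

lemma braid_hom_longest_rel:
  assumes "admissible Q L1" "admissible Q L2"
  shows "word_hom M braid_word (artin_lift M' (longest_rel M' L1 L2)) =
    artin_lift M (longest_rel M (blow Q L1) (blow Q L2))"
proof -
  have L: "L1 \<subseteq> I'" "L2 \<subseteq> I'" using assms by (auto simp: admissible_def)
  show ?thesis
    unfolding S.longest_rel_eq[OF L] T.longest_rel_eq[OF blow_subset blow_subset] w0_blow_comp[OF assms]
    by (intro braid_hom_lift S.W_comp S.w0_W L)
qed

lemma braid_hom_gen:
  assumes i: "i \<in> I'"
  shows "word_hom M braid_word (artin_gen M' i) =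
    artin_lift M (longest_rel M (blow (near i) {}) (blow (near i) {i}))"
  unfolding T.longest_rel_eq[OF blow_subset blow_subset] cable_gen[OF i, symmetric]
    T.artin_lift_word[OF cable_gen_W[OF i]]
  using braid.word_hom_gen[OF i] by (simp add: braid_word_def)

lemma braid_hom_coxeter_type: "coxeter_type M' M (word_hom M braid_word)"
proof -
  \<comment> \<open>The value is read off from any word of the class; all words in
    \<open>S.elt w\<close> have the permutation \<open>w\<close>.\<close>
  define \<phi> where "\<phi> x = T.elt (cable m (S.perm (SOME u. u \<in> x)))" for x
  have \<phi>: "\<phi> (S.elt w) = T.elt (cable m w)" if w: "w \<in> S.W I'" for w
  proof -
    have "\<exists>u. u \<in> S.elt w" using w by (auto simp: S.elt_def S.W_def)
    then have "(SOME u. u \<in> S.elt w) \<in> S.elt w" by (rule someI_ex)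
    then show ?thesis by (simp add: \<phi>_def S.elt_def)
  qed
  have proj: "artin_to_coxeter M' (artin_word M' u) = S.elt (S.perm u)" if u: "u \<in> lists I'" for u
  proof -
    have "coxeter_word M' v = S.elt (S.perm u)" if "v \<in> artin_word M' u" for v
      using that S.perm_artin_cong[of u v] word_cong_lists[of I' "braid_relations M'" u v]
      by (simp add: artin_word_def word_class_def S.coxeter_word_eq)
    moreover have "u \<in> artin_word M' u"
      using u by (simp add: artin_word_def word_class_def word_cong.refl)
    ultimately show ?thesis unfolding artin_to_coxeter_def by blast
  qed
  have proj2: "artin_to_coxeter M (artin_word M u) = T.elt (T.perm u)" if u: "u \<in> lists I" for u
  proof -
    have "coxeter_word M v = T.elt (T.perm u)" if "v \<in> artin_word M u" for v
      using that T.perm_artin_cong[of u v] word_cong_lists[of I "braid_relations M" u v]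
      by (simp add: artin_word_def word_class_def T.coxeter_word_eq)
    moreover have "u \<in> artin_word M u"
      using u by (simp add: artin_word_def word_class_def word_cong.refl)
    ultimately show ?thesis unfolding artin_to_coxeter_def by blast
  qed
  have "\<phi> \<in> hom (coxeter_group M') (coxeter_group M)"
    by (auto simp: hom_def S.carrier_coxeter_group T.carrier_coxeter_group \<phi> cable_W S.elt_mult
        T.elt_mult S.W_comp cable_comp[OF m])
  moreover have "\<phi> (artin_to_coxeter M' x) = artin_to_coxeter M (word_hom M braid_word x)"
    if x: "x \<in> carrier (artin_monoid M')" for x
  proof -
    obtain u where u: "x = artin_word M' u" "u \<in> lists I'"
      using x unfolding carrier_artin_monoid by (rule imageE)
    have W: "S.perm u \<in> S.W I'" unfolding S.W_def using u(2) by (rule imageI)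
    show ?thesis
      unfolding u(1) proj[OF u(2)] braid.word_hom_artin_word[OF u(2)]
        proj2[OF braid.concat_in_lists[OF u(2)]] concat_braid_word_perm[OF u(2)]
      by (rule \<phi>[OF W])
  qed
  ultimately show ?thesis unfolding coxeter_type_def by blast
qed

section \<open>Half twists of ribbons\<close>

text \<open>A ribbon and its mirror image are twisted together, so nonnegative \<open>q\<close>
  suffice as labels.\<close>

definition twist_word :: "int \<Rightarrow> 'i list" where
  "twist_word q = T.lift_word (T.w0 (blow {q, - 1 - q} {}))"

abbreviation twists :: "int list \<Rightarrow> 'i list" where
  "twists qs \<equiv> concat (map twist_word qs)"

lemma twist_word:
  assumes "q \<in> {0..<n}"
  shows "T.reduced (twist_word q)" "T.perm (twist_word q) = flip m {q, - 1 - q}"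
    "twist_word q \<in> lists I"
proof -
  have "admissible {q, - 1 - q} {}" using assms by (auto simp: admissible_def)
  then have "T.w0 (blow {q, - 1 - q} {}) = flip m {q, - 1 - q}"
    using m by (simp add: w0_blow S.w0_empty)
  then show "T.reduced (twist_word q)" "T.perm (twist_word q) = flip m {q, - 1 - q}"
    "twist_word q \<in> lists I"
    using T.lift_word[OF T.w0_W[OF blow_subset], of "{q, - 1 - q}" "{}"] by (auto simp: twist_word_def)
qed

lemma twists_in_lists: "set qs \<subseteq> {0..<n} \<Longrightarrow> twists qs \<in> lists I"
  using twist_word(3) by (induction qs) auto

text \<open>Half twists of different ribbons invert disjoint sets of pairs. A repeated ribbon would
  give a full twist, which is not reduced for \<open>m > 1\<close>.\<close>

lemma twists:
  assumes "distinct qs" "set qs \<subseteq> {0..<n}"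
  shows "T.reduced (twists qs) \<and> T.perm (twists qs) = flip m (set qs \<union> (\<lambda>q. - 1 - q) ` set qs)"
  using assms
proof (induction qs)
  case Nil
  show ?case using m by (simp add: T.reduced_Nil)
next
  case (Cons q qs)
  let ?R = "set qs \<union> (\<lambda>q. - 1 - q) ` set qs"
  have IH: "T.reduced (twists qs)" "T.perm (twists qs) = flip m ?R" and q: "q \<in> {0..<n}"
    using Cons by auto
  note tw = twist_word[OF q]
  have disj: "{q, - 1 - q} \<inter> ?R = {}" using Cons.prems by fastforce
  have "T.reduced (twist_word q @ twists qs)"
    using disj m
    by (intro T.reduced_append tw IH) (auto simp: tw IH flip_less_iff split: if_splits)
  moreover have "T.perm (twist_word q @ twists qs) = flip m ({q, - 1 - q} \<union> ?R)"
    by (simp only: T.perm_append tw IH flip_comp[OF m disj])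
  moreover have "{q, - 1 - q} \<union> ?R = set (q # qs) \<union> (\<lambda>q. - 1 - q) ` set (q # qs)" by auto
  ultimately show ?case by simp
qed

lemma twist_word_commute:
  assumes "p \<in> {0..<n}" "q \<in> {0..<n}"
  shows "T.artin_cong (twist_word p @ twist_word q) (twist_word q @ twist_word p)"
proof (cases "p = q")
  case True
  show ?thesis unfolding True by (rule word_cong.refl) (use twist_word(3)[OF assms(2)] in auto)
next
  case False
  then have pq: "distinct [p, q]" "set [p, q] \<subseteq> {0..<n}" and qp: "distinct [q, p]" "set [q, p] \<subseteq> {0..<n}"
    using assms by auto
  have "T.artin_cong (twists [p, q]) (twists [q, p])"
    using twists[OF pq] twists[OF qp] by (intro T.matsumoto) (auto simp: insert_commute)
  then show ?thesis by simp
qed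

lemma twist_word_twists_commute:
  assumes "p \<in> {0..<n}" "set qs \<subseteq> {0..<n}"
  shows "T.artin_cong (twist_word p @ twists qs) (twists qs @ twist_word p)"
  using assms(2)
proof (induction qs)
  case Nil
  show ?case using twist_word(3)[OF assms(1)] by (auto intro: word_cong.refl)
next
  case (Cons q qs)
  then have q: "q \<in> {0..<n}" and qs: "set qs \<subseteq> {0..<n}" by auto
  have "T.artin_cong ((twist_word p @ twist_word q) @ twists qs) ((twist_word q @ twist_word p) @ twists qs)"
    by (intro word_cong.append word_cong.refl twist_word_commute twists_in_lists assms q qs)
  moreover have "T.artin_cong (twist_word q @ (twist_word p @ twists qs)) (twist_word q @ (twists qs @ twist_word p))"
    by (intro word_cong.append[OF word_cong.refl] twist_word(3) q Cons.IH qs)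
  ultimately show ?case by (auto intro: word_cong.trans)
qed

lemma twists_cong:
  assumes "mset ps = mset qs" "set ps \<subseteq> {0..<n}"
  shows "T.artin_cong (twists ps) (twists qs)"
  using assms
proof (induction ps arbitrary: qs)
  case Nil
  then show ?case by (auto intro: word_cong.refl)
next
  case (Cons p ps)
  then have p: "p \<in> {0..<n}" and ps: "set ps \<subseteq> {0..<n}" by auto
  have "p \<in> set qs" using Cons.prems(1) by (metis list.set_intros(1) mset_eq_setD)
  then obtain as bs where qs: "qs = as @ p # bs" by (meson split_list)
  have set: "set as \<subseteq> {0..<n}" "set bs \<subseteq> {0..<n}"
    using Cons.prems mset_eq_setD[OF Cons.prems(1)] qs by auto
  have "T.artin_cong (twists ps) (twists (as @ bs))"
    by (rule Cons.IH[OF _ ps]) (use Cons.prems(1) qs in simp)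
  then have 1: "T.artin_cong (twist_word p @ twists ps) (twist_word p @ twists (as @ bs))"
    by (intro word_cong.append[OF word_cong.refl] twist_word(3) p)
  have "T.artin_cong ((twist_word p @ twists as) @ twists bs) ((twists as @ twist_word p) @ twists bs)"
    by (intro word_cong.append twist_word_twists_commute word_cong.refl twists_in_lists p set)
  with 1 show ?case by (auto simp: qs intro: word_cong.trans)
qed

text \<open>The image is folded back to the nonnegative member of its mirror pair, the label used by
  \<open>twist_word\<close>. Thus ribbon 0 stays 0 under the generator at position 0.\<close>

definition ribbon_image :: "'j \<Rightarrow> int \<Rightarrow> int" where
  "ribbon_image i q = (if 0 \<le> refl_at (pos' i) q then refl_at (pos' i) q else - 1 - refl_at (pos' i) q)"

lemma ribbon_image_range:
  assumes "i \<in> I'" "q \<in> {0..<n}"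
  shows "ribbon_image i q \<in> {0..<n}"
  using assms S.nonneg[OF assms(1)] pos'_less[OF assms(1)] by (auto simp: ribbon_image_def refl_at_def)

text \<open>A twist inverts pairs inside a ribbon and a crossing inverts pairs from different
  ribbons. Hence both products are reduced, and \<open>flip_cable\<close> equates their
  permutations.\<close>

lemma twist_braid_commute:
  assumes i: "i \<in> I'" and q: "q \<in> {0..<n}"
  shows "T.artin_cong (twist_word q @ braid_word i) (braid_word i @ twist_word (ribbon_image i q))"
proof (rule T.matsumoto)
  let ?g = "refl_at (pos' i)" and ?r = "ribbon_image i q"
  note tw = twist_word[OF q] and tw' = twist_word[OF ribbon_image_range[OF i q]] and b = braid_word[OF i]
  have eq: "?g x = y \<longleftrightarrow> x = ?g y" for x y by auto
  \<comment> \<open>The reflection is an involution commuting with the mirror, so the preimage of a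
    mirror pair is the mirror pair of the image of \<open>q\<close>.\<close>
  have "?g -` {q, - 1 - q} = {?r, - 1 - ?r}"
    unfolding vimage_def ribbon_image_def by (auto simp: eq refl_at_mirror)
  then show "T.perm (twist_word q @ braid_word i) = T.perm (braid_word i @ twist_word ?r)"
    by (simp only: T.perm_append tw tw' b flip_cable[OF m])
  show "T.reduced (twist_word q @ braid_word i)"
  proof (intro T.reduced_append tw b)
    fix x y assume xy: "x < y" "T.perm (braid_word i) y < T.perm (braid_word i) x"
    have "cable m ?g y div m \<noteq> cable m ?g x div m"
      using xy sym_perm_inj[OF sym_perm_refl_at]
      by (auto simp: b cable_less_iff[OF m sym_perm_refl_at] m split: if_splits)
    then show "T.perm (twist_word q) (T.perm (braid_word i) y) < T.perm (twist_word q) (T.perm (braid_word i) x)"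
      using xy(2) by (auto simp: tw b flip_less_iff[OF m])
  qed
  show "T.reduced (braid_word i @ twist_word ?r)"
    by (intro T.reduced_append tw' b)
      (auto simp: tw' b m flip_less_iff[OF m] cable_less_iff[OF m sym_perm_refl_at] split: if_splits)
qed

lemma twists_braid_commute:
  assumes i: "i \<in> I'" and "set qs \<subseteq> {0..<n}"
  shows "T.artin_cong (twists qs @ braid_word i) (braid_word i @ twists (map (ribbon_image i) qs))"
  using assms(2)
proof (induction qs)
  case Nil
  show ?case using braid_word(3)[OF i] by (auto intro: word_cong.refl)
next
  case (Cons q qs)
  then have q: "q \<in> {0..<n}" and qs: "set qs \<subseteq> {0..<n}" by auto
  have qs': "set (map (ribbon_image i) qs) \<subseteq> {0..<n}" using ribbon_image_range[OF i] qs by auto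
  have "T.artin_cong (twist_word q @ (twists qs @ braid_word i))
      (twist_word q @ (braid_word i @ twists (map (ribbon_image i) qs)))"
    by (intro word_cong.append[OF word_cong.refl] twist_word(3) q Cons.IH qs)
  moreover have "T.artin_cong ((twist_word q @ braid_word i) @ twists (map (ribbon_image i) qs))
      ((braid_word i @ twist_word (ribbon_image i q)) @ twists (map (ribbon_image i) qs))"
    by (intro word_cong.append twist_braid_commute word_cong.refl twists_in_lists qs' i q)
  ultimately show ?case by (auto intro: word_cong.trans)
qed

text \<open>At position 0 a ribbon crosses its own mirror image, so only one half twist
  occurs.\<close>

definition near_ribbons :: "'j \<Rightarrow> int list" where
  "near_ribbons i = (if pos' i = 0 then [0] else [pos' i - 1, pos' i])"

lemma near_ribbons:
  assumes "i \<in> I'"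
  shows "distinct (near_ribbons i)" "set (near_ribbons i) \<subseteq> {0..<n}"
    "set (near_ribbons i) \<union> (\<lambda>q. - 1 - q) ` set (near_ribbons i) = near i"
  using S.nonneg[OF assms] pos'_less[OF assms] by (auto simp: near_ribbons_def near_def)

definition half_twist_word :: "'j \<Rightarrow> 'i list" where
  "half_twist_word i = T.lift_word (T.w0 (blow (near i) {i}))"

text \<open>The factorization of \<open>w0_blow\<close>, lifted to the Artin monoid: no pair is
  inverted by both factors, so the product of reduced words stays reduced.\<close>

lemma half_twist_word_split:
  assumes i: "i \<in> I'"
  shows "T.artin_cong (half_twist_word i) (braid_word i @ twists (near_ribbons i))"
proof (rule T.matsumoto)
  note ht = T.lift_word[OF T.w0_W[OF blow_subset], of "near i" "{i}", folded half_twist_word_def]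
  have w: "T.w0 (blow (near i) {i}) = cable m (refl_at (pos' i)) \<circ> flip m (near i)"
    by (simp add: w0_blow[OF admissible_near[OF i]] S.w0_singleton[OF i])
  note tw = twists[OF near_ribbons(1,2)[OF i], unfolded near_ribbons(3)[OF i]]
  note b = braid_word[OF i]
  show "T.reduced (half_twist_word i)" by (rule ht)
  show "T.perm (half_twist_word i) = T.perm (braid_word i @ twists (near_ribbons i))"
    using tw by (simp only: ht w T.perm_append b)
  show "T.reduced (braid_word i @ twists (near_ribbons i))"
    using tw
    by (intro T.reduced_append b)
      (auto simp: b m flip_less_iff[OF m] cable_less_iff[OF m sym_perm_refl_at] split: if_splits)
qed

text \<open>The ribbons, with multiplicity, carrying a half twist once all half twists of a word have
  been moved to the right.\<close>

definition collected :: "'j list \<Rightarrow> int list" where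
  "collected u = foldl (\<lambda>qs i. map (ribbon_image i) qs @ near_ribbons i) [] u"

text \<open>Appending a letter pushes the twists collected so far through its crossing, which
  relabels them, and adds the twists of the letter itself.\<close>

lemma concat_half_twist_word:
  assumes "u \<in> lists I'"
  shows "set (collected u) \<subseteq> {0..<n} \<and>
    T.artin_cong (concat (map half_twist_word u)) (concat (map braid_word u) @ twists (collected u))"
  using assms
proof (induction u rule: rev_induct)
  case Nil
  show ?case by (auto simp: collected_def intro: word_cong.refl)
next
  case (snoc i u)
  then have i: "i \<in> I'" and u: "u \<in> lists I'" by auto
  let ?b = "concat (map braid_word u)" and ?c = "collected u"
  have IH: "set ?c \<subseteq> {0..<n}" "T.artin_cong (concat (map half_twist_word u)) (?b @ twists ?c)"
    using snoc.IH[OF u] by auto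
  have c': "set (map (ribbon_image i) ?c) \<subseteq> {0..<n}" using ribbon_image_range[OF i] IH(1) by auto
  have col: "collected (u @ [i]) = map (ribbon_image i) ?c @ near_ribbons i" by (simp add: collected_def)
  have near: "twists (near_ribbons i) \<in> lists I" by (rule twists_in_lists[OF near_ribbons(2)[OF i]])
  have 1: "T.artin_cong (concat (map half_twist_word u) @ half_twist_word i)
      ((?b @ twists ?c) @ (braid_word i @ twists (near_ribbons i)))"
    by (intro word_cong.append IH half_twist_word_split i)
  have 2: "T.artin_cong (?b @ ((twists ?c @ braid_word i) @ twists (near_ribbons i)))
      (?b @ ((braid_word i @ twists (map (ribbon_image i) ?c)) @ twists (near_ribbons i)))"
    by (intro word_cong_refl_append word_cong.append word_cong.refl twists_braid_commute IH i near
        braid.concat_in_lists u)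
  from 1 2 have "T.artin_cong (concat (map half_twist_word (u @ [i])))
      (concat (map braid_word (u @ [i])) @ twists (collected (u @ [i])))"
    unfolding col by (auto intro: word_cong.trans)
  moreover have "set (collected (u @ [i])) \<subseteq> {0..<n}"
    using c' near_ribbons(2)[OF i] by (simp add: col)
  ultimately show ?case by blast
qed

text \<open>For order 2 the two letters do not affect each other's ribbons. For order 3 each of the
  three ribbons ends with two half twists, for order 4 each of the ribbons 0 and 1 with
  three.\<close>

lemma collected_braid:
  assumes ij: "i \<in> I'" "j \<in> I'" "i \<noteq> j" "mat M' i j = enat k"
  shows "mset (collected (alternating i j k)) = mset (collected (alternating j i k))"
  using ij(1-3)
proof (cases rule: S.bmat_cases)
  case two
  then have "k = 2" using ij by simp
  moreover have "map (ribbon_image j) (near_ribbons i) = near_ribbons i"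
    "map (ribbon_image i) (near_ribbons j) = near_ribbons j"
    using two(2) S.nonneg[OF ij(1)] S.nonneg[OF ij(2)]
    by (auto simp: near_ribbons_def ribbon_image_def refl_at_eq_self)
  ultimately show ?thesis by (simp add: alternating_2 collected_def)
next
  case three
  then have k: "k = 3" using ij by simp
  from three(2) show ?thesis
  proof
    assume e: "pos' i = pos' j + 1"
    have vals: "refl_at (pos' j) (pos' j + 1) = pos' j + 1" "refl_at (pos' j + 1) (pos' j - 1) = pos' j - 1"
      "refl_at (pos' j + 1) (pos' j) = pos' j + 1" "refl_at (pos' j + 1) (pos' j + 1) = pos' j"
      using three(4) by (auto simp: refl_at_def)
    show ?thesis
      using three(3,4)
      by (simp add: k alternating_3 collected_def near_ribbons_def ribbon_image_def e refl_at_values vals)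
  next
    assume e: "pos' j = pos' i + 1"
    have vals: "refl_at (pos' i) (pos' i + 1) = pos' i + 1" "refl_at (pos' i + 1) (pos' i - 1) = pos' i - 1"
      "refl_at (pos' i + 1) (pos' i) = pos' i + 1" "refl_at (pos' i + 1) (pos' i + 1) = pos' i"
      using three(3) by (auto simp: refl_at_def)
    show ?thesis
      using three(3,4)
      by (simp add: k alternating_3 collected_def near_ribbons_def ribbon_image_def e refl_at_values vals)
  qed
next
  case four
  then have k: "k = 4" using ij by simp
  have vals: "refl_at 0 0 = - 1" "refl_at 0 1 = 1" "refl_at 1 0 = 1" "refl_at 1 1 = 0"
    by (simp_all add: refl_at_def)
  from four(2) show ?thesis
    by (elim disjE conjE)
      (simp_all add: k alternating_4 collected_def near_ribbons_def ribbon_image_def vals)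
qed

lemma half_twist_word_in_lists: "half_twist_word i \<in> lists I"
  unfolding half_twist_word_def by (intro T.lift_word T.w0_W blow_subset)

lemma half_twist_word_braid:
  assumes ij: "i \<in> I'" "j \<in> I'" "i \<noteq> j" "mat M' i j = enat k"
  shows "T.artin_cong (concat (map half_twist_word (alternating i j k)))
    (concat (map half_twist_word (alternating j i k)))"
proof -
  let ?u = "alternating i j k" and ?v = "alternating j i k"
  have "?u \<in> lists I'" "?v \<in> lists I'" by (rule alternating_in_lists; fact)+
  note u = concat_half_twist_word[OF this(1)] and v = concat_half_twist_word[OF this(2)]
  have "T.artin_cong (concat (map braid_word ?u) @ twists (collected ?u))
      (concat (map braid_word ?v) @ twists (collected ?v))"
    using u by (intro word_cong.append braid_word_braid twists_cong collected_braid ij) auto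
  with u v show ?thesis by (blast intro: word_cong.trans word_cong.sym)
qed

sublocale half_twist: artin_hom M' M half_twist_word
  by unfold_locales (rule half_twist_word_in_lists, rule half_twist_word_braid)

lemma half_twist_hom_gen:
  "i \<in> I' \<Longrightarrow> word_hom M half_twist_word (artin_gen M' i) = artin_lift M (longest M (blow (near i) {i}))"
  by (simp add: half_twist.word_hom_gen T.artin_lift_longest blow_subset half_twist_word_def)

lemma half_twist_hom_standard: "standard_hom M' M (word_hom M half_twist_word)"
  unfolding standard_hom_def using half_twist_hom_gen blow_subset by blast

end

section \<open>Support and parabolicity\<close>

lemma artin_support_artin_word:
  assumes "u \<in> lists (index M)"
  shows "set u \<subseteq> artin_support (artin_word M u)" "artin_support (artin_word M u) \<subseteq> index M"
proof -
  have "u \<in> artin_word M u"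
    using assms by (simp add: artin_word_def word_class_def word_cong.refl)
  then show "set u \<subseteq> artin_support (artin_word M u)" unfolding artin_support_def by blast
  show "artin_support (artin_word M u) \<subseteq> index M"
  proof
    fix j assume "j \<in> artin_support (artin_word M u)"
    then obtain v where v: "v \<in> artin_word M u" "j \<in> set v" by (auto simp: artin_support_def)
    then have "v \<in> lists (index M)"
      using word_cong_lists[of "index M" "braid_relations M" u v]
      by (simp only: artin_word_def word_class_def mem_Collect_eq)
    with v show "j \<in> index M" by auto
  qed
qed

lemma submonoid_generated_minimal:
  "submonoid H G \<Longrightarrow> S \<subseteq> H \<Longrightarrow> submonoid_generated G S \<subseteq> H"
  unfolding submonoid_generated_def by (rule hull_minimal)

lemma submonoid_submonoid_generated:
  assumes "monoid G" "S \<subseteq> carrier G"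
  shows "submonoid (submonoid_generated G S) G"
proof
  have "submonoid (carrier G) G"
    using assms(1) by (intro submonoid.intro) (auto intro: monoid.m_closed monoid.one_closed)
  then show "submonoid_generated G S \<subseteq> carrier G"
    by (rule submonoid_generated_minimal) (rule assms)
  show "x \<otimes>\<^bsub>G\<^esub> y \<in> submonoid_generated G S"
    if "x \<in> submonoid_generated G S" "y \<in> submonoid_generated G S" for x y
    using that unfolding submonoid_generated_def hull_def by (auto intro: submonoid.m_closed)
  show "\<one>\<^bsub>G\<^esub> \<in> submonoid_generated G S"
    unfolding submonoid_generated_def hull_def by (auto intro: submonoid.one_closed)
qed

text \<open>The preimage of the target submonoid is a submonoid containing the generators.\<close>

lemma image_submonoid_generated:
  assumes G: "monoid G" and H: "monoid H" and f: "f \<in> monoid_hom G H"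
    and S: "S \<subseteq> carrier G" and S': "S' \<subseteq> carrier H" "f ` S \<subseteq> S'"
  shows "f ` submonoid_generated G S \<subseteq> submonoid_generated H S'"
proof -
  interpret P: submonoid "submonoid_generated H S'" H
    by (rule submonoid_submonoid_generated[OF H S'(1)])
  have "submonoid {x \<in> carrier G. f x \<in> submonoid_generated H S'} G"
    using f G by (intro submonoid.intro)
      (auto simp: monoid_hom_def hom_def monoid.m_closed monoid.one_closed)
  moreover have "S \<subseteq> {x \<in> carrier G. f x \<in> submonoid_generated H S'}"
    using S S' hull_subset[of S' "\<lambda>K. submonoid K H"] unfolding submonoid_generated_def by blast
  ultimately show ?thesis using submonoid_generated_minimal by blast
qed

section \<open>Explicit intervals, support and parabolicity of the cabling homomorphism\<close>

context cabling begin

text \<open>For \<open>pos' i > 0\<close> the mirror ribbons in \<open>near i\<close> contain no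
  nonnegative position, so only the two adjacent ribbons and the crossing between them
  contribute.\<close>

lemma blow_near_iff:
  assumes i: "i \<in> I'" "0 < pos' i"
  shows "j \<in> blow (near i) {i} \<longleftrightarrow>
      j \<in> I \<and> m * (pos' i - 1) < pos j \<and> pos j < m * (pos' i + 1)"
    and "j \<in> blow (near i) {} \<longleftrightarrow> j \<in> blow (near i) {i} \<and> pos j \<noteq> m * pos' i"
proof -
  define q where "q = pos j div m"
  note bd = div_bounds[OF m, of "pos j", folded q_def]
  have dvd: "m dvd pos j \<longleftrightarrow> pos j = m * q"
    unfolding q_def by (metis dvd_triv_left dvd_mult_div_cancel)
  have key: "(if pos j = m * q then q = pos' i else q \<in> near i) \<longleftrightarrow>
    m * (pos' i - 1) < pos j \<and> pos j < m * (pos' i + 1)" if j: "j \<in> I"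
  proof
    have "0 \<le> pos j" using T.nonneg j by simp
    then have q0: "0 \<le> q" using m by (simp add: q_def pos_imp_zdiv_nonneg_iff)
    assume "if pos j = m * q then q = pos' i else q \<in> near i"
    then consider "pos j = m * pos' i" | "q = pos' i - 1" "pos j \<noteq> m * q" | "q = pos' i"
      using q0 i(2) by (auto simp: near_def split: if_splits)
    then show "m * (pos' i - 1) < pos j \<and> pos j < m * (pos' i + 1)"
    proof cases
      case 1
      then show ?thesis using m by (simp add: algebra_simps)
    next
      case 2
      then have e: "pos' i = q + 1" by simp
      show ?thesis using bd m 2(2) unfolding e by (auto simp: algebra_simps)
    next
      case 3
      then show ?thesis using bd m by (auto simp: algebra_simps)
    qed
  next
    assume b: "m * (pos' i - 1) < pos j \<and> pos j < m * (pos' i + 1)"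
    then have "m * q < m * (pos' i + 1)" "m * (pos' i - 1) < m * (q + 1)" using bd by linarith+
    then have "q < pos' i + 1" "pos' i - 1 < q + 1" using m by simp_all
    then have "q = pos' i \<or> q = pos' i - 1" by linarith
    then show "if pos j = m * q then q = pos' i else q \<in> near i" using b by (auto simp: near_def)
  qed
  show "j \<in> blow (near i) {i} \<longleftrightarrow> j \<in> I \<and> m * (pos' i - 1) < pos j \<and> pos j < m * (pos' i + 1)"
    using key m by (auto simp: blow_def dvd q_def[symmetric])
  show "j \<in> blow (near i) {} \<longleftrightarrow> j \<in> blow (near i) {i} \<and> pos j \<noteq> m * pos' i"
    using m by (auto simp: blow_def)
qed

lemma blow_near_0_iff:
  assumes i: "i \<in> I'" "pos' i = 0"
  shows "j \<in> blow (near i) {i} \<longleftrightarrow> j \<in> I \<and> pos j < m"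
    and "j \<in> blow (near i) {} \<longleftrightarrow> j \<in> blow (near i) {i} \<and> pos j \<noteq> 0"
proof -
  have div: "pos j div m = 0 \<longleftrightarrow> pos j < m" "0 \<le> pos j div m" if "j \<in> I"
    using T.nonneg[OF that] m by (auto simp: div_pos_pos_trivial zdiv_eq_0_iff pos_imp_zdiv_nonneg_iff)
  show "j \<in> blow (near i) {i} \<longleftrightarrow> j \<in> I \<and> pos j < m"
    using div i(2) by (auto simp: blow_def near_def)
  show "j \<in> blow (near i) {} \<longleftrightarrow> j \<in> blow (near i) {i} \<and> pos j \<noteq> 0"
    using m i(2) by (auto simp: blow_def)
qed

lemma admissible_all: "L \<subseteq> I' \<Longrightarrow> admissible {- n..<n} L"
  using S.nonneg pos'_less by (fastforce simp: admissible_def)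

lemma blow_all: "blow {- n..<n} I' = I"
proof -
  have "j \<in> blow {- n..<n} I'" if j: "j \<in> I" for j
  proof -
    have *: "0 \<le> pos j" "pos j < m * n" "m dvd pos j \<longrightarrow> pos j div m \<in> pos' ` I'"
      using pos_image j by auto
    have "m * (pos j div m) < m * n" using div_bounds(1)[OF m, of "pos j"] *(2) by linarith
    then have "pos j div m < n" using m by simp
    moreover have "0 \<le> pos j div m" using *(1) m by (simp add: pos_imp_zdiv_nonneg_iff)
    ultimately show ?thesis using j *(3) by (auto simp: blow_def)
  qed
  then show ?thesis using blow_subset by blast
qed

text \<open>If \<open>j\<close> did not occur in \<open>braid_word i\<close>, its permutation would
  preserve the cut at \<open>pos j\<close>; but the ribbon crossing carries a line across that
  cut.\<close>

lemma hom_support_braid_hom: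
  assumes cover: "\<And>j. j \<in> I \<Longrightarrow> \<exists>i\<in>I'. m * (pos' i - 1) < pos j \<and> pos j < m * (pos' i + 1)"
  shows "hom_support M' (word_hom M braid_word) = I"
proof -
  let ?supp = "\<lambda>i. artin_support (word_hom M braid_word (artin_gen M' i))"
  have supp: "set (braid_word i) \<subseteq> ?supp i" "?supp i \<subseteq> I" if i: "i \<in> I'" for i
    unfolding braid.word_hom_gen[OF i] by (intro artin_support_artin_word braid_word(3) i)+
  have "j \<in> (\<Union>i\<in>I'. ?supp i)" if j: "j \<in> I" for j
  proof -
    obtain i where i: "i \<in> I'" and e: "m * (pos' i - 1) < pos j" "pos j < m * (pos' i + 1)"
      using cover[OF j] by blast
    \<comment> \<open>A line of ribbon \<open>pos' i - 1\<close> to the left of the cut. The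
      crossing moves it by \<open>m\<close>, hence to the right of the cut: it is the last line of
      the ribbon unless the cut comes earlier.\<close>
    define y where "y = min (pos j - 1) (m * pos' i - 1)"
    have y: "m * (pos' i - 1) \<le> y" "y < m * pos' i" "y < pos j" "pos j \<le> y + m"
      using e m by (auto simp: y_def algebra_simps)
    have "m * (y div m) < m * pos' i" "m * (pos' i - 1) < m * (y div m + 1)"
      using div_bounds[OF m, of y] y(1,2) by linarith+
    then have "y div m < pos' i" "pos' i - 1 < y div m + 1" using m by simp_all
    then have "y div m = pos' i - 1" by linarith
    moreover from this have "y mod m = y - m * (pos' i - 1)" by (metis minus_mult_div_eq_mod)
    ultimately have dm: "y div m = pos' i - 1" "y mod m = y - m * (pos' i - 1)" .
    have "cable m (refl_at (pos' i)) y = y + m"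
      by (simp add: cable_def dm refl_at_values algebra_simps)
    then have crosses: "\<not> (T.perm (braid_word i) y < pos j \<longleftrightarrow> y < pos j)"
      using y by (simp add: braid_word(2)[OF i])
    have "j \<in> set (braid_word i)"
    proof (rule ccontr)
      assume "j \<notin> set (braid_word i)"
      then have "braid_word i \<in> lists (I - {j})" using braid_word(3)[OF i] by auto
      then have "T.perm (braid_word i) \<in> T.W (I - {j})" unfolding T.W_def by (rule imageI)
      moreover have "pos j \<notin> T.links (I - {j})"
        using T.nonneg[OF j] T.pos_eq_iff[OF j] by (auto simp: T.links_def)
      ultimately show False using T.W_preserves_cut[of _ "I - {j}"] crosses by blast
    qed
    then show ?thesis using i supp(1)[OF i] by blast
  qed
  then have "I \<subseteq> (\<Union>i\<in>I'. ?supp i)" by (rule subsetI)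
  moreover have "(\<Union>i\<in>I'. ?supp i) \<subseteq> I" using supp(2) by (rule UN_least)
  ultimately show ?thesis unfolding hom_support_def by (rule equalityI[rotated])
qed

text \<open>Taking all ribbons as \<open>Q\<close> blows the full index set up to \<open>I\<close>.
  The witness for \<open>L\<close> consists of all positions inside ribbons and the crossings
  belonging to \<open>L\<close>.\<close>

lemma braid_hom_longest_rel_all:
  assumes "L \<subseteq> I'"
  shows "word_hom M braid_word (artin_lift M' (longest_rel M' L I')) =
    artin_lift M (longest_rel M (blow {- n..<n} L) I)"
  using braid_hom_longest_rel[OF admissible_all[OF assms] admissible_all[OF subset_refl]]
  by (simp only: blow_all)

lemma braid_hom_strict_parabolic:
  assumes "hom_support M' (word_hom M braid_word) = I"
  shows "strict_parabolic M' M (word_hom M braid_word)"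
  unfolding strict_parabolic_def assms
proof (intro allI impI exI conjI)
  show "blow {- n..<n} L \<subseteq> I" for L by (rule blow_subset)
qed (rule braid_hom_longest_rel_all)

text \<open>Since both index sets are connected, the generators of the two submonoids are relative
  to the full sets, and \<open>braid_hom_longest_rel_all\<close> sends generators to
  generators.\<close>

lemma braid_hom_parabolic:
  assumes "hom_support M' (word_hom M braid_word) = I"
    and "components M' I' = {I'}" "components M I = {I}"
  shows "parabolic_hom M' M (word_hom M braid_word)"
  unfolding parabolic_hom_def parabolic_submonoid_def assms
proof (rule image_submonoid_generated[OF monoid_artin_monoid monoid_artin_monoid
      braid.word_hom_in_monoid_hom])
  show "{artin_lift M' (longest_rel M' J C) |J C. C \<in> {I'} \<and> J \<subseteq> C} \<subseteq> carrier (artin_monoid M')"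
    using S.lift_word(3)[OF S.W_comp[OF S.w0_W S.w0_W]]
    by (auto simp: carrier_artin_monoid S.artin_lift_longest_rel simp del: in_lists_conv_set)
  show "{artin_lift M (longest_rel M J C) |J C. C \<in> {I} \<and> J \<subseteq> C} \<subseteq> carrier (artin_monoid M)"
    using T.lift_word(3)[OF T.W_comp[OF T.w0_W T.w0_W]]
    by (auto simp: carrier_artin_monoid T.artin_lift_longest_rel simp del: in_lists_conv_set)
  show "word_hom M braid_word ` {artin_lift M' (longest_rel M' J C) |J C. C \<in> {I'} \<and> J \<subseteq> C}
      \<subseteq> {artin_lift M (longest_rel M J C) |J C. C \<in> {I} \<and> J \<subseteq> C}"
  proof clarsimp
    fix J assume "J \<subseteq> I'"
    then show "\<exists>J'. word_hom M braid_word (artin_lift M' (longest_rel M' J I')) =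
        artin_lift M (longest_rel M J' I) \<and> J' \<subseteq> I"
      by (intro exI conjI) (rule braid_hom_longest_rel_all, assumption, rule blow_subset)
  qed
qed

end

section \<open>Types A and B\<close>

lemma components_type_B:
  assumes "0 < k"
  shows "components (type_B k) {1..k} = {{1..k}}"
proof -
  let ?K = "{1..k}" and ?R = "{(a, b) \<in> {1..k} \<times> {1..k}. mat (type_B k) a b > 2}"
  have "(2::enat) < 3" "(2::enat) < 4" by simp_all
  then have edge: "(i, i + 1) \<in> ?R" "(i + 1, i) \<in> ?R" if "1 \<le> i" "i + 1 \<le> k" for i
    using that by (auto simp: type_B_def type_A_def)
  have path: "(1, i) \<in> ?R\<^sup>* \<and> (i, 1) \<in> ?R\<^sup>*" if "1 \<le> i" "i \<le> k" for i
    using that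
  proof (induction i rule: int_ge_induct)
    case (step i)
    then have "(1, i) \<in> ?R\<^sup>*" "(i, 1) \<in> ?R\<^sup>*" by auto
    with edge[of i] step show ?case
      by (meson converse_rtrancl_into_rtrancl rtrancl.rtrancl_into_rtrancl)
  qed simp
  have "(i, j) \<in> ?R\<^sup>*" if "i \<in> ?K" "j \<in> ?K" for i j
    using path[of i] path[of j] that by (meson atLeastAtMost_iff rtrancl_trans)
  then have "{(i, j) \<in> ?K \<times> ?K. (i, j) \<in> ?R\<^sup>*} = ?K \<times> ?K" by blast
  then have "components (type_B k) ?K = ?K // (?K \<times> ?K)" by (simp only: components_def)
  also have "\<dots> = {?K}" using assms by (auto simp: quotient_def Image_def)
  finally show ?thesis .
qed

lemma coxeter_B_type_B: "coxeter_B (type_B k) (\<lambda>i. k - i)"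
  by unfold_locales
    (auto simp: type_B_def type_A_def bmat_def inj_on_def doubleton_eq_iff abs_minus_commute)

text \<open>The positions run from 1 to \<open>k - 1\<close>; as 0 is missing, the bond of order 4
  in \<open>bmat\<close> never occurs.\<close>

lemma coxeter_B_type_A: "coxeter_B (type_A (k - 1)) (\<lambda>i. k - i)"
  by unfold_locales
    (auto simp: type_A_def bmat_def inj_on_def doubleton_eq_iff abs_minus_commute)

lemma index_type_A [simp]: "index (type_A k) = {1..k}"
  and index_type_B [simp]: "index (type_B k) = {1..k}"
  by (simp_all add: type_A_def type_B_def)

text \<open>Position 0 is missing for the lines and for the ribbons alike, which is consistent
  because 0 is the multiple of \<open>m\<close> with quotient 0.\<close>

lemma cabling_type_A:
  assumes "0 < m"
  shows "cabling (type_A (n - 1)) (\<lambda>i. n - i) (type_A (n * m - 1)) (\<lambda>j. n * m - j) m n"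
proof (intro cabling.intro cabling_axioms.intro coxeter_B_type_A)
  have "x \<in> {1..n * m - 1} \<longleftrightarrow> 0 \<le> x \<and> x < m * n \<and> (m dvd x \<longrightarrow> x div m \<in> {1..n - 1})" for x
  proof (cases "m dvd x")
    case True
    then obtain y where x: "x = m * y" by blast
    have "1 \<le> m * y \<longleftrightarrow> 0 < y" "0 \<le> m * y \<longleftrightarrow> 0 \<le> y" "m * y \<le> n * m - 1 \<longleftrightarrow> y < n"
      using assms zero_less_mult_iff[of m y] zero_le_mult_iff[of m y] mult_less_cancel_left_pos[OF assms, of y n]
      by (auto simp: mult.commute[of n m] int_one_le_iff_zero_less)
    then show ?thesis using x assms by auto
  next
    case False
    then have "x \<noteq> 0" by auto
    then show ?thesis using False by (auto simp: mult.commute)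
  qed
  note iff = this
  have im: "(\<lambda>j. n * m - j) ` {1..n * m - 1} = {1..n * m - 1}" "(\<lambda>i. n - i) ` {1..n - 1} = {1..n - 1}"
    by simp_all
  show "(\<lambda>j. n * m - j) ` index (type_A (n * m - 1)) =
      {x. 0 \<le> x \<and> x < m * n \<and> (m dvd x \<longrightarrow> x div m \<in> (\<lambda>i. n - i) ` index (type_A (n - 1)))}"
    unfolding index_type_A im by (rule Set.set_eqI) (simp only: mem_Collect_eq iff)
qed (use assms in auto)

lemma cabling_type_B:
  assumes "0 < m"
  shows "cabling (type_B n) (\<lambda>i. n - i) (type_B (m * n)) (\<lambda>j. m * n - j) m n"
proof (intro cabling.intro cabling_axioms.intro coxeter_B_type_B)
  have "x \<in> {0..m * n - 1} \<longleftrightarrow> 0 \<le> x \<and> x < m * n \<and> (m dvd x \<longrightarrow> x div m \<in> {0..n - 1})" for x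
  proof (cases "m dvd x")
    case True
    then obtain y where x: "x = m * y" by blast
    have "0 \<le> m * y \<longleftrightarrow> 0 \<le> y" "m * y < m * n \<longleftrightarrow> y < n"
      using assms zero_le_mult_iff[of m y] by auto
    then show ?thesis using x assms by auto
  qed auto
  note iff = this
  have im: "(\<lambda>j. m * n - j) ` {1..m * n} = {0..m * n - 1}" "(\<lambda>i. n - i) ` {1..n} = {0..n - 1}"
    by simp_all
  show "(\<lambda>j. m * n - j) ` index (type_B (m * n)) =
      {x. 0 \<le> x \<and> x < m * n \<and> (m dvd x \<longrightarrow> x div m \<in> (\<lambda>i. n - i) ` index (type_B n))}"
    unfolding index_type_B im by (rule Set.set_eqI) (simp only: mem_Collect_eq iff)
qed (use assms in auto)

text \<open>Passing to positions turns the interval around; its excluded neighbours become multiples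
  of \<open>m\<close>, as in \<open>blow_near_iff\<close>.\<close>

lemma J_block_iff:
  assumes "N = m * n"
  shows "j \<in> J_block m i \<longleftrightarrow> m * (n - i - 1) < N - j \<and> N - j < m * (n - i + 1)"
  using assms by (auto simp: J_block_def algebra_simps)

lemma J_block_subset:
  assumes "0 < m" "1 \<le> i" "i < n"
  shows "J_block m i \<subseteq> {1..m * n - 1}"
proof -
  have "0 \<le> (i - 1) * m" "(i + 1) * m \<le> n * m"
    using assms by (auto intro: mult_right_mono)
  then show ?thesis by (auto simp: J_block_def mult.commute)
qed

theorem theorem5p52:
  fixes m n :: int
  assumes "m > 1" and "n > 0"
  shows
    "(\<exists>\<Phi> \<in> monoid_hom (artin_monoid (type_A (n - 1))) (artin_monoid (type_A (n * m - 1))).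
       (\<forall>i\<in>{1..n - 1}. \<Phi> (artin_gen (type_A (n - 1)) i) =
          artin_lift (type_A (n * m - 1))
            (longest_rel (type_A (n * m - 1)) (J_block m i - {i * m}) (J_block m i))) \<and>
       strict_parabolic (type_A (n - 1)) (type_A (n * m - 1)) \<Phi> \<and>
       coxeter_type (type_A (n - 1)) (type_A (n * m - 1)) \<Phi>) \<and>
     (\<exists>\<Phi> \<in> monoid_hom (artin_monoid (type_A (n - 1))) (artin_monoid (type_A (n * m - 1))).
       (\<forall>i\<in>{1..n - 1}. \<Phi> (artin_gen (type_A (n - 1)) i) =
          artin_lift (type_A (n * m - 1)) (longest (type_A (n * m - 1)) (J_block m i))) \<and>
       standard_hom (type_A (n - 1)) (type_A (n * m - 1)) \<Phi>) \<and>
     (\<exists>\<Phi> \<in> monoid_hom (artin_monoid (type_B n)) (artin_monoid (type_B (m * n))).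
       (\<forall>i\<in>{1..n - 1}. \<Phi> (artin_gen (type_B n) i) =
          artin_lift (type_B (m * n))
            (longest_rel (type_B (m * n)) (J_block m i - {i * m}) (J_block m i))) \<and>
       \<Phi> (artin_gen (type_B n) n) =
          artin_lift (type_B (m * n))
            (longest_rel (type_B (m * n)) {(n - 1) * m + 1 .. n * m - 1} {(n - 1) * m + 1 .. n * m}) \<and>
       parabolic_hom (type_B n) (type_B (m * n)) \<Phi> \<and>
       coxeter_type (type_B n) (type_B (m * n)) \<Phi>) \<and>
     (\<exists>\<Phi> \<in> monoid_hom (artin_monoid (type_B n)) (artin_monoid (type_B (m * n))).
       (\<forall>i\<in>{1..n - 1}. \<Phi> (artin_gen (type_B n) i) =
          artin_lift (type_B (m * n)) (longest (type_B (m * n)) (J_block m i))) \<and>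
       \<Phi> (artin_gen (type_B n) n) =
          artin_lift (type_B (m * n)) (longest (type_B (m * n)) {(n - 1) * m + 1 .. n * m}) \<and>
       standard_hom (type_B n) (type_B (m * n)) \<Phi>)"
proof -
  have m: "0 < m" using assms by simp
  interpret A: cabling "type_A (n - 1)" "\<lambda>i. n - i" "type_A (n * m - 1)" "\<lambda>j. n * m - j" m n
    by (rule cabling_type_A[OF m])
  interpret B: cabling "type_B n" "\<lambda>i. n - i" "type_B (m * n)" "\<lambda>j. m * n - j" m n
    by (rule cabling_type_B[OF m])
  have blowA: "A.blow (A.near i) {i} = J_block m i" "A.blow (A.near i) {} = J_block m i - {i * m}"
    if i: "i \<in> {1..n - 1}" for i
  proof -
    have sub: "J_block m i \<subseteq> {1..n * m - 1}" using J_block_subset[OF m, of i n] i by (simp add: mult.commute)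
    have i': "i \<in> index (type_A (n - 1))" "0 < n - i" using i by auto
    show 1: "A.blow (A.near i) {i} = J_block m i"
      using A.blow_near_iff(1)[OF i'] sub J_block_iff[of "n * m" m n _ i]
      by (auto simp: set_eq_iff mult.commute)
    show "A.blow (A.near i) {} = J_block m i - {i * m}"
      using A.blow_near_iff(2)[OF i'] 1 by (auto simp: set_eq_iff algebra_simps)
  qed
  have blowB: "B.blow (B.near i) {i} = J_block m i" "B.blow (B.near i) {} = J_block m i - {i * m}"
    if i: "i \<in> {1..n - 1}" for i
  proof -
    have sub: "J_block m i \<subseteq> {1..m * n}" using J_block_subset[OF m, of i n] i by auto
    have i': "i \<in> index (type_B n)" "0 < n - i" using i by auto
    show 1: "B.blow (B.near i) {i} = J_block m i"
      using B.blow_near_iff(1)[OF i'] sub J_block_iff[of "m * n" m n _ i]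
      by (auto simp: set_eq_iff)
    show "B.blow (B.near i) {} = J_block m i - {i * m}"
      using B.blow_near_iff(2)[OF i'] 1 by (auto simp: set_eq_iff algebra_simps)
  qed
  have n: "n \<in> index (type_B n)" "n - n = 0" using assms by auto
  have e: "(n - 1) * m = m * n - m" "n * m = m * n" by (simp_all add: algebra_simps)
  have "0 \<le> m * (n - 1)" using assms by simp
  then have "m \<le> m * n" by (simp add: right_diff_distrib)
  then have le: "1 \<le> x" if "m * n - m + 1 \<le> x" for x using that by linarith
  have blowBn: "B.blow (B.near n) {n} = {(n - 1) * m + 1..n * m}"
    "B.blow (B.near n) {} = {(n - 1) * m + 1..n * m - 1}"
    unfolding e set_eq_iff B.blow_near_0_iff[OF n] index_type_B
    by (auto intro: le)
  have coverA: "\<exists>i\<in>{1..n - 1}. m * (n - i - 1) < n * m - j \<and> n * m - j < m * (n - i + 1)"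
    if "n \<noteq> 1" and j: "j \<in> {1..n * m - 1}" for j
  proof -
    let ?e = "n * m - j"
    have d: "m * (?e div m) \<le> ?e" "?e < m * (?e div m + 1)" by (rule div_bounds[OF m])+
    have "m * (?e div m) < m * n" using d j by (auto simp: mult.commute)
    then have lt: "?e div m < n" using m by simp
    have ge: "0 \<le> ?e div m" using j m by (simp add: pos_imp_zdiv_nonneg_iff)
    show ?thesis
    proof (cases "?e div m = 0")
      \<comment> \<open>In type A no generator sits at position 0, so ribbon 0 is reached through
        the crossing of ribbons 0 and 1, generator \<open>n - 1\<close>, which exists because
        \<open>n\<close> is not 1.\<close>
      case True
      then show ?thesis
        using d j that(1) assms by (intro bexI[of _ "n - 1"]) auto
    next
      case False
      then show ?thesis
        using d lt ge m by (intro bexI[of _ "n - ?e div m"]) (auto simp: algebra_simps)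
    qed
  qed
  have coverB: "\<exists>i\<in>{1..n}. m * (n - i - 1) < m * n - j \<and> m * n - j < m * (n - i + 1)"
    if j: "j \<in> {1..m * n}" for j
  proof -
    let ?e = "m * n - j"
    have d: "m * (?e div m) \<le> ?e" "?e < m * (?e div m + 1)" by (rule div_bounds[OF m])+
    have "m * (?e div m) < m * n" using d j by auto
    then have lt: "?e div m < n" using m by simp
    have ge: "0 \<le> ?e div m" using j m by (simp add: pos_imp_zdiv_nonneg_iff)
    show ?thesis
      using d lt ge m by (intro bexI[of _ "n - ?e div m"]) (auto simp: algebra_simps)
  qed
  have "strict_parabolic (type_A (n - 1)) (type_A (n * m - 1)) (word_hom (type_A (n * m - 1)) A.braid_word)"
  proof (cases "n = 1")
    case True
    \<comment> \<open>Without generators the support is empty and not the whole target index set, so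
      \<open>braid_hom_strict_parabolic\<close> does not apply. The only relative longest element is
      the one for empty sets, and it goes to its counterpart.\<close>
    have adm: "A.admissible {} {}" by (simp add: A.admissible_def)
    have "A.blow {} {} = {}" by (simp add: A.blow_def)
    then show ?thesis
      using A.braid_hom_longest_rel[OF adm adm] True
      by (auto simp: strict_parabolic_def hom_support_def)
  next
    case False
    show ?thesis
      by (intro A.braid_hom_strict_parabolic A.hom_support_braid_hom) (use coverA[OF False] in auto)
  qed
  then have a: "\<exists>\<Phi> \<in> monoid_hom (artin_monoid (type_A (n - 1))) (artin_monoid (type_A (n * m - 1))).
       (\<forall>i\<in>{1..n - 1}. \<Phi> (artin_gen (type_A (n - 1)) i) =
          artin_lift (type_A (n * m - 1))
            (longest_rel (type_A (n * m - 1)) (J_block m i - {i * m}) (J_block m i))) \<and>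
       strict_parabolic (type_A (n - 1)) (type_A (n * m - 1)) \<Phi> \<and>
       coxeter_type (type_A (n - 1)) (type_A (n * m - 1)) \<Phi>"
    using A.braid.word_hom_in_monoid_hom A.braid_hom_coxeter_type A.braid_hom_gen
    by (intro bexI[of _ "word_hom (type_A (n * m - 1)) A.braid_word"]) (auto simp: blowA)
  have b: "\<exists>\<Phi> \<in> monoid_hom (artin_monoid (type_A (n - 1))) (artin_monoid (type_A (n * m - 1))).
       (\<forall>i\<in>{1..n - 1}. \<Phi> (artin_gen (type_A (n - 1)) i) =
          artin_lift (type_A (n * m - 1)) (longest (type_A (n * m - 1)) (J_block m i))) \<and>
       standard_hom (type_A (n - 1)) (type_A (n * m - 1)) \<Phi>"
    using A.half_twist.word_hom_in_monoid_hom A.half_twist_hom_standard A.half_twist_hom_gen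
    by (intro bexI[of _ "word_hom (type_A (n * m - 1)) A.half_twist_word"]) (auto simp: blowA)
  have "parabolic_hom (type_B n) (type_B (m * n)) (word_hom (type_B (m * n)) B.braid_word)"
    using assms m
    by (intro B.braid_hom_parabolic B.hom_support_braid_hom) (use coverB in \<open>auto simp: components_type_B\<close>)
  then have c: "\<exists>\<Phi> \<in> monoid_hom (artin_monoid (type_B n)) (artin_monoid (type_B (m * n))).
       (\<forall>i\<in>{1..n - 1}. \<Phi> (artin_gen (type_B n) i) =
          artin_lift (type_B (m * n))
            (longest_rel (type_B (m * n)) (J_block m i - {i * m}) (J_block m i))) \<and>
       \<Phi> (artin_gen (type_B n) n) =
          artin_lift (type_B (m * n))
            (longest_rel (type_B (m * n)) {(n - 1) * m + 1 .. n * m - 1} {(n - 1) * m + 1 .. n * m}) \<and>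
       parabolic_hom (type_B n) (type_B (m * n)) \<Phi> \<and>
       coxeter_type (type_B n) (type_B (m * n)) \<Phi>"
    using B.braid.word_hom_in_monoid_hom B.braid_hom_coxeter_type B.braid_hom_gen n
    by (intro bexI[of _ "word_hom (type_B (m * n)) B.braid_word"]) (auto simp: blowB blowBn)
  have d: "\<exists>\<Phi> \<in> monoid_hom (artin_monoid (type_B n)) (artin_monoid (type_B (m * n))).
       (\<forall>i\<in>{1..n - 1}. \<Phi> (artin_gen (type_B n) i) =
          artin_lift (type_B (m * n)) (longest (type_B (m * n)) (J_block m i))) \<and>
       \<Phi> (artin_gen (type_B n) n) =
          artin_lift (type_B (m * n)) (longest (type_B (m * n)) {(n - 1) * m + 1 .. n * m}) \<and>
       standard_hom (type_B n) (type_B (m * n)) \<Phi>"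
    using B.half_twist.word_hom_in_monoid_hom B.half_twist_hom_standard B.half_twist_hom_gen n
    by (intro bexI[of _ "word_hom (type_B (m * n)) B.half_twist_word"]) (auto simp: blowB blowBn)
  show ?thesis using a b c d by (intro conjI)
qed

end
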